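(* Let $g:(0,\infty)\to\mathbb{R}$ be a bounded continuous function with $g>0$. Let $u$ be a bounded solution in $\mathbb{H}=\mathbb{R}\times\mathbb{R}^+$ of the heat equation $u_t=u_{xx}$ with initial condition $u(x,0)=f(x)$, $x\in\mathbb{R}$, where $f$ is a continuous bounded function on $\mathbb{R}$. Assume that $u$ vanishes on the graph of $g$, i.e. $u(x,g(x))=0$ for all $x\in(0,\infty)$. Then $u(x,0)=0$ for all $x\in\mathbb{R}$.
   Context: $\mathbb{R}^+=(0,\infty)$ and $\mathbb{H}=\mathbb{R}\times\mathbb{R}^+$ is the open half-plane of points $(x,t)$ with $t>0$. A bounded solution of the initial value problem is a bounded real-valued function $u$ satisfying $u_t=u_{xx}$ classically in $\mathbb{H}$, continuous up to $t=0$, with $u(x,0)=f(x)$ for $x\in\mathbb{R}$, where the initial datum $f$ is continuous and bounded on $\mathbb{R}$. *)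

theory Defs
  imports "HOL-Analysis.Analysis"
begin

text \<open>Functions \<open>u :: real \<Rightarrow> real \<Rightarrow> real\<close> are written \<open>u x t\<close>. Only the values at
  \<open>t \<ge> 0\<close> are relevant below; the derivatives at \<open>t > 0\<close> do not see the values at \<open>t < 0\<close>.\<close>

text \<open>The derivatives are only required to exist pointwise; their continuity is not assumed.\<close>

definition classical_heat_solution :: "(real \<Rightarrow> real \<Rightarrow> real) \<Rightarrow> bool" where
  "classical_heat_solution u \<longleftrightarrow>
     (\<forall>x. \<forall>t>0.
        (\<lambda>s. u x s) field_differentiable at t \<and>
        (\<lambda>y. u y t) field_differentiable at x \<and>
        deriv (\<lambda>y. u y t) field_differentiable at x \<and>
        deriv (\<lambda>s. u x s) t = deriv (deriv (\<lambda>y. u y t)) x)"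

definition bounded_heat_ivp_solution :: "(real \<Rightarrow> real) \<Rightarrow> (real \<Rightarrow> real \<Rightarrow> real) \<Rightarrow> bool" where
  "bounded_heat_ivp_solution f u \<longleftrightarrow>
     bounded ((\<lambda>(x, t). u x t) ` (UNIV \<times> {0<..})) \<and>
     classical_heat_solution u \<and>
     continuous_on (UNIV \<times> {0..}) (\<lambda>(x, t). u x t) \<and>
     (\<forall>x. u x 0 = f x)"

end

theory Submission
  imports Defs "HOL-Probability.Probability" "HOL-Complex_Analysis.Complex_Analysis" "HOL-Real_Asymp.Real_Asymp"
begin

text \<open>
  The zero curve acts as an absorbing boundary, and this makes \<open>u\<close> decay too fast to the right.

  Fix \<open>T\<close> above \<open>g\<close> and let \<open>\<delta> = g 1 > 0\<close>. In the region above the graph and to the right of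
  \<open>x = 1\<close> the parabolic boundary consists of the graph, on which \<open>u = 0\<close>, and of the half-line
  \<open>x = 1\<close>, \<open>t \<ge> \<delta>\<close>. Whatever enters the region does so through this half-line, hence only after
  time \<open>\<delta>\<close>. A heat kernel that starts at the point \<open>(1, \<delta>/2)\<close> therefore dominates \<open>\<bar>u\<bar>\<close>,
  and \<open>u(x, T) = O(exp (- (x - 1)\<^sup>2 / (4 (T - \<delta>/2))))\<close> as \<open>x \<rightarrow> +\<infinity>\<close>
  (\<open>zero_curve_decay\<close>). What matters is that \<open>T - \<delta>/2\<close> is less than \<open>T\<close>.

  On the other hand \<open>u(x, T)\<close> is the convolution of \<open>f\<close> with the heat kernel
  (\<open>bounded_heat_solution_eq_gauss_mean\<close>). Completing the square, \<open>u(x, T)\<close> is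
  \<open>exp (- x\<^sup>2 / (4 T))\<close> times a two-sided Laplace transform of a function with Gaussian decay.
  After scaling, this transform \<open>\<Psi>\<close> is entire, bounded by a constant times
  \<open>exp ((Re z)\<^sup>2 / 2)\<close>, and by the decay of \<open>u\<close> it is \<open>O(exp (- c s\<^sup>2))\<close> on the positive
  real axis for some \<open>c > 0\<close>. A Carlson-type argument with the Phragmen-Lindelof principle shows
  that such a function vanishes identically (\<open>entire_gaussian_decay_imp_zero\<close>), and then \<open>f = 0\<close>
  because the transform is injective (\<open>gauss_laplace_injective\<close>).
\<close>

section \<open>Maximum principle for the heat operator\<close>

text \<open>The value \<open>c\<close> is \<open>u\<^sub>t - u\<^sub>x\<^sub>x\<close> at the single point \<open>(x, t)\<close>. Working pointwise suits the
  classical notion of solution, in which the derivatives need not be continuous.\<close>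
definition heat_defect_at :: "(real \<Rightarrow> real \<Rightarrow> real) \<Rightarrow> real \<Rightarrow> real \<Rightarrow> real \<Rightarrow> bool" where
  "heat_defect_at u x t c \<longleftrightarrow>
     (\<exists>p a. (\<forall>\<^sub>F y in nhds x. ((\<lambda>y. u y t) has_real_derivative p y) (at y)) \<and>
            (p has_real_derivative a) (at x) \<and>
            ((\<lambda>s. u x s) has_real_derivative a + c) (at t))"

lemma heat_defect_at_lincomb:
  assumes "heat_defect_at u x t c" "heat_defect_at v x t d"
  shows "heat_defect_at (\<lambda>x t. \<alpha> * u x t + \<beta> * v x t) x t (\<alpha> * c + \<beta> * d)"
proof -
  obtain p a where u: "\<forall>\<^sub>F y in nhds x. ((\<lambda>y. u y t) has_real_derivative p y) (at y)"
    "(p has_real_derivative a) (at x)" "((\<lambda>s. u x s) has_real_derivative a + c) (at t)"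
    using assms(1) by (auto simp: heat_defect_at_def)
  obtain q b where v: "\<forall>\<^sub>F y in nhds x. ((\<lambda>y. v y t) has_real_derivative q y) (at y)"
    "(q has_real_derivative b) (at x)" "((\<lambda>s. v x s) has_real_derivative b + d) (at t)"
    using assms(2) by (auto simp: heat_defect_at_def)
  have 1: "\<forall>\<^sub>F y in nhds x.
      ((\<lambda>y. \<alpha> * u y t + \<beta> * v y t) has_real_derivative \<alpha> * p y + \<beta> * q y) (at y)"
    using u(1) v(1) by eventually_elim (auto intro!: derivative_eq_intros)
  have 2: "((\<lambda>y. \<alpha> * p y + \<beta> * q y) has_real_derivative \<alpha> * a + \<beta> * b) (at x)"
    using u(2) v(2) by (auto intro!: derivative_eq_intros)
  have 3: "((\<lambda>s. \<alpha> * u x s + \<beta> * v x s) has_real_derivative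
      (\<alpha> * a + \<beta> * b) + (\<alpha> * c + \<beta> * d)) (at t)"
    using u(3) v(3) by (auto intro!: derivative_eq_intros simp: algebra_simps)
  show ?thesis
    unfolding heat_defect_at_def by (intro exI conjI) (rule 1, rule 2, rule 3)
qed

lemma classical_heat_solution_defect:
  assumes "classical_heat_solution u" "t > 0"
  shows "heat_defect_at u x t 0"
proof -
  note * = assms(1)[unfolded classical_heat_solution_def, rule_format, OF assms(2)]
  show ?thesis
    unfolding heat_defect_at_def
  proof (intro exI conjI)
    show "\<forall>\<^sub>F y in nhds x. ((\<lambda>y. u y t) has_real_derivative deriv (\<lambda>y. u y t) y) (at y)"
      using * by (auto intro!: always_eventually simp: field_differentiable_derivI)
    show "(deriv (\<lambda>y. u y t) has_real_derivative deriv (deriv (\<lambda>y. u y t)) x) (at x)"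
      using * by (auto simp: field_differentiable_derivI)
    show "((\<lambda>s. u x s) has_real_derivative deriv (deriv (\<lambda>y. u y t)) x + 0) (at t)"
      using * [of x] by (metis add_0_right field_differentiable_derivI)
  qed
qed

text \<open>The barrier for unbounded regions: it grows in space, and its defect is strictly positive, so
  subtracting a small multiple of it turns a solution into a strict subsolution.\<close>
lemma quadratic_heat_defect: "heat_defect_at (\<lambda>x t. x\<^sup>2 + 3 * t) x t 1"
  unfolding heat_defect_at_def
  by (rule exI[of _ "\<lambda>x. 2 * x"], rule exI[of _ 2]) (auto intro!: derivative_eq_intros always_eventually)

text \<open>Otherwise the first derivative, which vanishes at \<open>x\<close>, would be positive just to the right of
  \<open>x\<close> and the function would exceed its maximum there.\<close>
lemma second_derivative_local_max_nonpos:
  fixes f :: "real \<Rightarrow> real"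
  assumes "\<forall>\<^sub>F y in nhds x. (f has_real_derivative p y) (at y)"
    and "(p has_real_derivative a) (at x)"
    and "r > 0" and max: "\<And>y. \<bar>y - x\<bar> < r \<Longrightarrow> f y \<le> f x"
  shows "a \<le> 0"
proof (rule ccontr)
  assume "\<not> a \<le> 0"
  then have "a > 0" by simp
  obtain s where s: "s > 0" "\<And>y. \<bar>y - x\<bar> < s \<Longrightarrow> (f has_real_derivative p y) (at y)"
    using assms(1) unfolding eventually_nhds_metric by (auto simp: dist_real_def)
  have "p x = 0"
    by (rule DERIV_local_max[OF s(2)[of x] \<open>r > 0\<close>]) (use s max in \<open>auto simp: abs_minus_commute\<close>)
  obtain d where d: "d > 0" "\<And>h. 0 < h \<Longrightarrow> h < d \<Longrightarrow> p x < p (x + h)"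
    using DERIV_pos_inc_right[OF assms(2) \<open>a > 0\<close>] by auto
  define h where "h = min r (min s d) / 2"
  have h: "0 < h" "h < r" "h < s" "h < d"
    using \<open>r > 0\<close> s(1) d(1) by (auto simp: h_def)
  have "f x < f (x + h)"
  proof (rule DERIV_pos_imp_increasing_open[where f = f])
    show "\<exists>y. (f has_real_derivative y) (at z) \<and> y > 0" if "x < z" "z < x + h" for z
      using s(2)[of z] d(2)[of "z - x"] that h \<open>p x = 0\<close> by (intro exI[of _ "p z"]) auto
    show "continuous_on {x..x + h} f"
      using h by (intro continuous_at_imp_continuous_on ballI DERIV_isCont[OF s(2)]) auto
  qed (use h in auto)
  with max[of "x + h"] h show False by auto
qed

text \<open>At a positive maximum of a strict subsolution the second space derivative is at most \<open>0\<close>, and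
  the time derivative is at least \<open>0\<close> even if the point lies on the final time slice, because only
  earlier times are compared. This contradicts a negative defect. The hypothesis thus has to hold only at
  points of \<open>K\<close> that have a horizontal neighbourhood and a past in \<open>K\<close>; all other points play
  the part of the parabolic boundary, where \<open>e\<close> must not be positive.\<close>
lemma heat_max_principle:
  fixes e :: "real \<Rightarrow> real \<Rightarrow> real"
  assumes K: "compact K" and cont: "continuous_on K (\<lambda>(x, t). e x t)"
    and int: "\<And>x t. (x, t) \<in> K \<Longrightarrow> e x t > 0 \<Longrightarrow>
       \<exists>c<0. heat_defect_at e x t c \<and>
         (\<exists>r>0. (\<forall>y. \<bar>y - x\<bar> < r \<longrightarrow> (y, t) \<in> K) \<and> (\<forall>s. t - r < s \<and> s \<le> t \<longrightarrow> (x, s) \<in> K))"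
    and "(x, t) \<in> K"
  shows "e x t \<le> 0"
proof (rule ccontr)
  assume "\<not> e x t \<le> 0"
  obtain P where P: "P \<in> K" "\<And>Q. Q \<in> K \<Longrightarrow> (case Q of (x, t) \<Rightarrow> e x t) \<le> (case P of (x, t) \<Rightarrow> e x t)"
    using continuous_attains_sup[OF K _ cont] assms(4) by blast
  obtain y s where ys: "P = (y, s)" by (cases P)
  have max: "(z, r) \<in> K \<Longrightarrow> e z r \<le> e y s" for z r
    using P(2)[of "(z, r)"] ys by simp
  have "e y s > 0"
    using max[OF assms(4)] \<open>\<not> e x t \<le> 0\<close> by simp
  then obtain c r where c: "c < 0" "heat_defect_at e y s c" "r > 0"
    "\<And>z. \<bar>z - y\<bar> < r \<Longrightarrow> (z, s) \<in> K" "\<And>q. s - r < q \<Longrightarrow> q \<le> s \<Longrightarrow> (y, q) \<in> K"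
    using int[of y s] P(1) ys by blast
  obtain p a where a: "\<forall>\<^sub>F z in nhds y. ((\<lambda>z. e z s) has_real_derivative p z) (at z)"
    "(p has_real_derivative a) (at y)" "((\<lambda>q. e y q) has_real_derivative a + c) (at s)"
    using c(2) unfolding heat_defect_at_def by blast
  have "a \<le> 0"
    by (rule second_derivative_local_max_nonpos[OF a(1,2) \<open>r > 0\<close>]) (use c(4) max in auto)
  then have "a + c < 0" using \<open>c < 0\<close> by simp
  from DERIV_neg_dec_left[OF a(3) this] obtain d where
    d: "d > 0" "\<And>h. 0 < h \<Longrightarrow> h < d \<Longrightarrow> e y s < e y (s - h)" by auto
  define h where "h = min r d / 2"
  have "0 < h" "h < r" "h < d" using \<open>r > 0\<close> d(1) by (auto simp: h_def)
  with d(2)[of h] max[OF c(5)[of "s - h"]] show False by auto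
qed

text \<open>The region above a graph is unbounded to the right, so the barrier \<open>\<epsilon> (x\<^sup>2 + 3 t)\<close> is subtracted
  in order to confine the positive part to a compact set; then \<open>\<epsilon>\<close> tends to \<open>0\<close>.\<close>
lemma comparison_above_graph:
  fixes d :: "real \<Rightarrow> real \<Rightarrow> real"
  assumes G: "continuous_on {a..} G" "\<And>x. x \<ge> a \<Longrightarrow> 0 \<le> G x"
    and cont: "continuous_on {(x, t). a \<le> x \<and> G x \<le> t \<and> t \<le> T} (\<lambda>(x, t). d x t)"
    and bdd: "\<And>x t. a \<le> x \<Longrightarrow> G x \<le> t \<Longrightarrow> t \<le> T \<Longrightarrow> d x t \<le> C"
    and heat: "\<And>x t. a < x \<Longrightarrow> G x < t \<Longrightarrow> t \<le> T \<Longrightarrow> heat_defect_at d x t 0"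
    and side: "\<And>t. G a \<le> t \<Longrightarrow> t \<le> T \<Longrightarrow> d a t \<le> 0"
    and bot: "\<And>x. a \<le> x \<Longrightarrow> G x \<le> T \<Longrightarrow> d x (G x) \<le> 0"
    and x: "a \<le> x" "G x \<le> t" "t \<le> T"
  shows "d x t \<le> 0"
proof -
  have "d x t \<le> \<epsilon> * (x\<^sup>2 + 3 * t)" if "\<epsilon> > 0" for \<epsilon>
  proof -
    define e where "e = (\<lambda>x t. 1 * d x t + (- \<epsilon>) * (x\<^sup>2 + 3 * t))"
    \<comment> \<open>Beyond \<open>R\<close> the barrier exceeds the bound \<open>C\<close>; the \<open>+ 1\<close> makes \<open>R \<ge> 1\<close>, hence \<open>R \<le> R\<^sup>2\<close>.\<close>
    define R where "R = max (\<bar>x\<bar>) (\<bar>C\<bar> / \<epsilon> + 1)"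
    have "R \<ge> 1" using that by (simp add: R_def le_max_iff_disj)
    have "C < \<epsilon> * R\<^sup>2"
    proof -
      have "C < \<epsilon> * (\<bar>C\<bar> / \<epsilon> + 1)"
        using that by (simp add: distrib_left)
      also have "\<dots> \<le> \<epsilon> * R"
        using that by (simp add: R_def)
      also have "\<dots> \<le> \<epsilon> * R\<^sup>2"
        using that \<open>R \<ge> 1\<close> by (simp add: power2_eq_square)
      finally show ?thesis .
    qed
    define K where "K = {(x, t). a \<le> x \<and> x \<le> R \<and> G x \<le> t \<and> t \<le> T}"
    have K_eq: "K = {P \<in> {a..R} \<times> {0..T}. G (fst P) \<le> snd P}"
      using G(2) by (force simp: K_def)
    have "continuous_on ({a..R} \<times> {0..T}) (\<lambda>P. G (fst P))"
      by (intro continuous_on_compose2[OF G(1)] continuous_intros) auto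
    then have "closed K"
      unfolding K_eq by (intro continuous_on_closed_Collect_le closed_Times continuous_intros) auto
    moreover have "bounded K"
      by (rule bounded_subset[of "{a..R} \<times> {0..T}"])
        (auto simp: K_eq intro!: bounded_Times)
    ultimately have "compact K" by (simp add: compact_eq_bounded_closed)
    have "e x t \<le> 0"
    proof (rule heat_max_principle[OF \<open>compact K\<close>, where e = e])
      have "continuous_on K (\<lambda>(x, t). d x t)"
        by (rule continuous_on_subset[OF cont]) (auto simp: K_def)
      then show "continuous_on K (\<lambda>(x, t). e x t)"
        unfolding e_def by (auto simp: case_prod_unfold intro!: continuous_intros)
      show "(x, t) \<in> K" using x by (auto simp: K_def R_def)
    next
      fix y s assume ys: "(y, s) \<in> K" and pos: "e y s > 0"
      then have *: "a \<le> y" "y \<le> R" "G y \<le> s" "s \<le> T" by (auto simp: K_def)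
      have "s \<ge> 0" using G(2) * by force
      have "d y s > 0"
      proof -
        have "0 \<le> \<epsilon> * (y\<^sup>2 + 3 * s)" using \<open>s \<ge> 0\<close> that by simp
        with pos show ?thesis by (simp add: e_def)
      qed
      have "y \<noteq> R"
      proof
        assume "y = R"
        then have "\<epsilon> * R\<^sup>2 \<le> \<epsilon> * (y\<^sup>2 + 3 * s)" using \<open>s \<ge> 0\<close> that by simp
        with bdd[of y s] * \<open>C < \<epsilon> * R\<^sup>2\<close> pos show False by (simp add: e_def)
      qed
      moreover have "y \<noteq> a" "G y \<noteq> s"
        using side[of s] bot[of y] * \<open>d y s > 0\<close> by auto
      ultimately have **: "a < y" "y < R" "G y < s" using * by auto
      have defect: "heat_defect_at e y s (1 * 0 + (- \<epsilon>) * 1)"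
        unfolding e_def by (rule heat_defect_at_lincomb[OF heat quadratic_heat_defect]) (use * ** in auto)
      have "isCont G y"
        by (rule continuous_on_interior[OF G(1)]) (use ** in auto)
      then have "\<forall>\<^sub>F z in nhds y. G z < s"
        using ** by (metis continuous_within eventually_nhds_conv_at order_tendstoD(2))
      moreover have "\<forall>\<^sub>F z in nhds y. z \<in> {a<..<R}"
        by (rule eventually_nhds_in_open) (use ** in auto)
      ultimately have "\<forall>\<^sub>F z in nhds y. (z, s) \<in> K"
        by eventually_elim (use * in \<open>auto simp: K_def\<close>)
      then obtain r where r: "r > 0" "\<And>z. \<bar>z - y\<bar> < r \<Longrightarrow> (z, s) \<in> K"
        unfolding eventually_nhds_metric by (auto simp: dist_real_def)
      show "\<exists>c<0. heat_defect_at e y s c \<and>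
         (\<exists>r>0. (\<forall>z. \<bar>z - y\<bar> < r \<longrightarrow> (z, s) \<in> K) \<and> (\<forall>q. s - r < q \<and> q \<le> s \<longrightarrow> (y, q) \<in> K))"
        using defect that r * **
        by (intro exI[of _ "-\<epsilon>"] conjI exI[of _ "min r (s - G y)"]) (auto simp: K_def)
    qed
    then show ?thesis by (simp add: e_def)
  qed
  then have "\<And>\<epsilon>. \<epsilon> > 0 \<Longrightarrow> d x t \<le> \<epsilon> * (\<bar>x\<^sup>2 + 3 * t\<bar> + 1)"
    by (smt (verit) mult_less_cancel_left_pos)
  then have bound: "\<And>\<epsilon>. \<epsilon> > 0 \<Longrightarrow> d x t \<le> \<epsilon> * (\<bar>x\<^sup>2 + 3 * t\<bar> + 1)" .
  have "d x t \<le> 0 + \<epsilon>" if "\<epsilon> > 0" for \<epsilon>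
  proof -
    have "\<bar>x\<^sup>2 + 3 * t\<bar> + 1 > 0" by linarith
    then show ?thesis
      using bound[of "\<epsilon> / (\<bar>x\<^sup>2 + 3 * t\<bar> + 1)"] that by simp
  qed
  then show ?thesis
    using field_le_epsilon by blast
qed

text \<open>Quantitative form of the fact that bounded boundary data far away have little influence: the
  barrier reaches \<open>C\<close> on the lateral sides, but near a fixed point it is of order \<open>1 / m\<^sup>2\<close>.\<close>
lemma comparison_on_rectangle:
  fixes d :: "real \<Rightarrow> real \<Rightarrow> real"
  assumes m: "m > 0"
    and cont: "continuous_on ({-m..m} \<times> {0..T}) (\<lambda>(x, t). d x t)"
    and heat: "\<And>x t. \<bar>x\<bar> < m \<Longrightarrow> 0 < t \<Longrightarrow> t \<le> T \<Longrightarrow> heat_defect_at d x t 0"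
    and bdd: "\<And>x t. \<bar>x\<bar> \<le> m \<Longrightarrow> 0 < t \<Longrightarrow> t \<le> T \<Longrightarrow> d x t \<le> C"
    and bot: "\<And>x. \<bar>x\<bar> \<le> m \<Longrightarrow> d x 0 \<le> 0"
    and C: "C > 0" and x: "\<bar>x\<bar> \<le> m" "0 \<le> t" "t \<le> T"
  shows "d x t \<le> C * (x\<^sup>2 + 3 * t) / m\<^sup>2"
proof -
  define e where "e = (\<lambda>x t. 1 * d x t + (- (C / m\<^sup>2)) * (x\<^sup>2 + 3 * t))"
  have "e x t \<le> 0"
  proof (rule heat_max_principle[where K = "{-m..m} \<times> {0..T}" and e = e])
    show "continuous_on ({-m..m} \<times> {0..T}) (\<lambda>(x, t). e x t)"
      unfolding e_def using cont m by (auto simp: case_prod_unfold intro!: continuous_intros)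
    show "(x, t) \<in> {-m..m} \<times> {0..T}" using x by auto
    show "compact ({-m..m} \<times> {0..T})" by (intro compact_Times) auto
  next
    fix y s assume "(y, s) \<in> {-m..m} \<times> {0..T}" and pos: "e y s > 0"
    then have *: "\<bar>y\<bar> \<le> m" "0 \<le> s" "s \<le> T" by auto
    have "0 \<le> C / m\<^sup>2 * (y\<^sup>2 + 3 * s)" using * m C by simp
    then have "d y s > 0" using pos by (simp add: e_def)
    then have "s > 0" using bot[of y] * by (cases "s = 0") auto
    have "\<bar>y\<bar> \<noteq> m"
    proof
      assume "\<bar>y\<bar> = m"
      then have "m\<^sup>2 = y\<^sup>2" by auto
      then have "C = C / m\<^sup>2 * y\<^sup>2" using m by (cases "y = 0") auto
      also have "\<dots> \<le> C / m\<^sup>2 * (y\<^sup>2 + 3 * s)" using m C * by (intro mult_left_mono) auto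
      finally have "C \<le> C / m\<^sup>2 * (y\<^sup>2 + 3 * s)" .
      with bdd[of y s] pos * \<open>s > 0\<close> show False by (simp add: e_def)
    qed
    then have "\<bar>y\<bar> < m" using * by auto
    have "heat_defect_at e y s (1 * 0 + (- (C / m\<^sup>2)) * 1)"
      unfolding e_def
      by (rule heat_defect_at_lincomb[OF heat quadratic_heat_defect]) (use * \<open>\<bar>y\<bar> < m\<close> \<open>s > 0\<close> in auto)
    then show "\<exists>c<0. heat_defect_at e y s c \<and>
         (\<exists>r>0. (\<forall>z. \<bar>z - y\<bar> < r \<longrightarrow> (z, s) \<in> {-m..m} \<times> {0..T}) \<and>
           (\<forall>q. s - r < q \<and> q \<le> s \<longrightarrow> (y, q) \<in> {-m..m} \<times> {0..T}))"
      using * \<open>\<bar>y\<bar> < m\<close> \<open>s > 0\<close> m C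
      by (intro exI[of _ "-(C / m\<^sup>2)"] conjI exI[of _ "min s (m - \<bar>y\<bar>)"]) auto
  qed
  then show ?thesis by (simp add: e_def)
qed

section \<open>The heat kernel and the representation of bounded solutions\<close>

definition heat_kernel :: "real \<Rightarrow> real \<Rightarrow> real" where
  "heat_kernel z t = exp (- z\<^sup>2 / (4 * t)) / sqrt (4 * pi * t)"

lemma heat_kernel_dx:
  assumes "t > 0"
  shows "((\<lambda>x. heat_kernel (x - y) t) has_real_derivative
           - (x - y) / (2 * t) * heat_kernel (x - y) t) (at x within A)"
proof -
  have "((\<lambda>x. exp (- (x - y)\<^sup>2 / (4 * t))) has_real_derivative
      - (x - y) / (2 * t) * exp (- (x - y)\<^sup>2 / (4 * t))) (at x within A)"
    using assms by (auto intro!: derivative_eq_intros simp: field_simps)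
  from DERIV_cdivide[OF this] show ?thesis
    unfolding heat_kernel_def by simp
qed

lemma heat_kernel_dxx:
  assumes "t > 0"
  shows "((\<lambda>x. - (x - y) / (2 * t) * heat_kernel (x - y) t) has_real_derivative
           ((x - y)\<^sup>2 / (4 * t\<^sup>2) - 1 / (2 * t)) * heat_kernel (x - y) t) (at x within A)"
  using assms
  by (auto intro!: derivative_eq_intros heat_kernel_dx simp: field_simps power2_eq_square)

lemma heat_kernel_dt:
  assumes "t > 0"
  shows "((\<lambda>t. heat_kernel z t) has_real_derivative
           (z\<^sup>2 / (4 * t\<^sup>2) - 1 / (2 * t)) * heat_kernel z t) (at t within A)"
proof -
  have *: "((\<lambda>t. exp (- z\<^sup>2 / (4 * t)) * (1 / sqrt (4 * pi) * t powr (- (1/2)))) has_real_derivative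
     (z\<^sup>2 / (4 * t\<^sup>2) - 1 / (2 * t)) * heat_kernel z t) (at t)"
    using assms
    by (auto intro!: derivative_eq_intros
        simp: field_simps heat_kernel_def powr_minus powr_half_sqrt power2_eq_square powr_diff real_sqrt_mult)
  have "((\<lambda>t. heat_kernel z t) has_real_derivative
           (z\<^sup>2 / (4 * t\<^sup>2) - 1 / (2 * t)) * heat_kernel z t) (at t)"
    by (rule DERIV_cong_ev[THEN iffD1, OF refl _ refl *])
      (use eventually_nhds_in_open[of "{0<..}" t] assms in
        \<open>auto elim!: eventually_mono simp: heat_kernel_def powr_minus powr_half_sqrt real_sqrt_mult field_simps\<close>)
  then show ?thesis by (rule has_field_derivative_at_within)
qed

lemma continuous_on_heat_kernel [continuous_intros]:
  assumes "continuous_on A p" "continuous_on A q" "\<And>z. z \<in> A \<Longrightarrow> q z > 0"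
  shows "continuous_on A (\<lambda>z. heat_kernel (p z) (q z))"
  unfolding heat_kernel_def using assms
  by (auto intro!: continuous_intros simp: less_imp_neq[symmetric])

lemma heat_kernel_defect:
  assumes "t > s"
  shows "heat_defect_at (\<lambda>x t. heat_kernel (x - y) (t - s)) x t 0"
  unfolding heat_defect_at_def
proof (intro exI conjI)
  show "\<forall>\<^sub>F x in nhds x. ((\<lambda>x. heat_kernel (x - y) (t - s)) has_real_derivative
           - (x - y) / (2 * (t - s)) * heat_kernel (x - y) (t - s)) (at x)"
    using assms by (intro always_eventually allI heat_kernel_dx) auto
  show "((\<lambda>x. - (x - y) / (2 * (t - s)) * heat_kernel (x - y) (t - s)) has_real_derivative
           ((x - y)\<^sup>2 / (4 * (t - s)\<^sup>2) - 1 / (2 * (t - s))) * heat_kernel (x - y) (t - s)) (at x)"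
    using assms by (intro heat_kernel_dxx) auto
  show "((\<lambda>t. heat_kernel (x - y) (t - s)) has_real_derivative
           ((x - y)\<^sup>2 / (4 * (t - s)\<^sup>2) - 1 / (2 * (t - s))) * heat_kernel (x - y) (t - s) + 0) (at t)"
    using DERIV_chain2[OF heat_kernel_dt DERIV_diff[OF DERIV_ident DERIV_const]] assms by simp
qed

text \<open>For data of compact support the integral runs over a compact interval, so differentiation under
  the integral sign needs only continuity of the integrand, and no domination at infinity.\<close>
lemma heat_potential_defect:
  assumes f: "continuous_on {a..b} f" and t: "t > 0"
  shows "heat_defect_at (\<lambda>x t. integral {a..b} (\<lambda>y. heat_kernel (x - y) t * f y)) x t 0"
proof -
  let ?k1 = "\<lambda>x t y. - (x - y) / (2 * t) * heat_kernel (x - y) t * f y"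
  let ?k2 = "\<lambda>x t y. ((x - y)\<^sup>2 / (4 * t\<^sup>2) - 1 / (2 * t)) * heat_kernel (x - y) t * f y"
  have f': "continuous_on (U \<times> {a..b}) (\<lambda>p. f (snd p))" for U :: "real set"
    by (intro continuous_on_compose2[OF f] continuous_intros) auto
  have 1: "((\<lambda>x. integral (cbox a b) (\<lambda>y. heat_kernel (x - y) t * f y)) has_field_derivative
      integral (cbox a b) (?k1 x t)) (at x within UNIV)" for x
    by (rule leibniz_rule_field_derivative)
       (use t f f' in \<open>auto intro!: derivative_eq_intros heat_kernel_dx integrable_continuous_interval
          continuous_intros simp: case_prod_unfold\<close>)
  have 2: "((\<lambda>x. integral (cbox a b) (?k1 x t)) has_field_derivative
      integral (cbox a b) (?k2 x t)) (at x within UNIV)" for x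
  proof (rule leibniz_rule_field_derivative)
    show "((\<lambda>x. ?k1 x t y) has_real_derivative ?k2 x t y) (at x within UNIV)" for x y
      by (rule DERIV_cmult_right[OF heat_kernel_dxx[OF t]])
  qed (use t f f' in \<open>auto intro!: integrable_continuous_interval continuous_intros simp: case_prod_unfold\<close>)
  have 3: "((\<lambda>t. integral (cbox a b) (\<lambda>y. heat_kernel (x - y) t * f y)) has_field_derivative
      integral (cbox a b) (?k2 x t)) (at t within {0<..})"
  proof (rule leibniz_rule_field_derivative)
    show "((\<lambda>t. heat_kernel (x - y) t * f y) has_real_derivative ?k2 x t y) (at t within {0<..})"
      if "t \<in> {0<..}" for t y
      by (rule DERIV_cmult_right[OF heat_kernel_dt]) (use that in auto)
  qed (use t f f' in \<open>auto intro!: integrable_continuous_interval continuous_intros simp: case_prod_unfold less_imp_neq[symmetric]\<close>)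
  then have 3: "((\<lambda>t. integral (cbox a b) (\<lambda>y. heat_kernel (x - y) t * f y)) has_field_derivative
      integral (cbox a b) (?k2 x t) + 0) (at t)"
    using t by (simp add: at_within_open[of t "{0<..}"])
  show ?thesis
    unfolding heat_defect_at_def using always_eventually[OF allI, OF 1] 2[of x] 3
    by (intro exI conjI) (auto simp: cbox_interval)
qed

lemma heat_defect_at_cong:
  assumes "heat_defect_at u x t c" "t > 0" and eq: "\<And>x t. t > 0 \<Longrightarrow> u x t = v x t"
  shows "heat_defect_at v x t c"
proof -
  have "\<forall>\<^sub>F s in nhds t. u x s = v x s"
    using eventually_nhds_in_open[of "{0<..}" t] \<open>t > 0\<close> by (auto elim!: eventually_mono intro: eq)
  then have "((\<lambda>s. u x s) has_real_derivative d) (at t) \<longleftrightarrow> ((\<lambda>s. v x s) has_real_derivative d) (at t)" for d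
    by (intro DERIV_cong_ev) auto
  moreover have "(\<lambda>y. u y t) = (\<lambda>y. v y t)" using eq[OF \<open>t > 0\<close>] by auto
  ultimately show ?thesis using assms(1) by (simp add: heat_defect_at_def)
qed

text \<open>The convolution of \<open>h\<close> with the heat kernel, after the substitution \<open>y = x + sqrt (2 t) z\<close>. In
  this form nothing is singular at \<open>t = 0\<close>, so continuity up to the initial line is
  dominated convergence.\<close>
definition gauss_mean :: "(real \<Rightarrow> real) \<Rightarrow> real \<Rightarrow> real \<Rightarrow> real" where
  "gauss_mean h x t = (LINT z|lborel. std_normal_density z * h (x + sqrt (2 * t) * z))"

lemma gauss_mean_tendsto:
  assumes h: "\<And>n. continuous_on UNIV (h n)" "continuous_on UNIV k"
    and bdd: "\<And>n y. \<bar>h n y\<bar> \<le> C"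
    and lim: "\<And>z. (\<lambda>n. h n (x n + sqrt (2 * t n) * z)) \<longlonglongrightarrow> k (y + sqrt (2 * s) * z)"
  shows "(\<lambda>n. gauss_mean (h n) (x n) (t n)) \<longlonglongrightarrow> gauss_mean k y s"
  unfolding gauss_mean_def
proof (rule integral_dominated_convergence[where w = "\<lambda>z. C * std_normal_density z"])
  have [measurable]: "h n \<in> borel_measurable borel" "k \<in> borel_measurable borel" for n
    using h by (auto intro: borel_measurable_continuous_onI)
  show "(\<lambda>z. std_normal_density z * k (y + sqrt (2 * s) * z)) \<in> borel_measurable lborel"
    "(\<lambda>z. std_normal_density z * h n (x n + sqrt (2 * t n) * z)) \<in> borel_measurable lborel" for n
    by measurable
  show "AE z in lborel. (\<lambda>n. std_normal_density z * h n (x n + sqrt (2 * t n) * z))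
      \<longlonglongrightarrow> std_normal_density z * k (y + sqrt (2 * s) * z)"
    by (intro AE_I2 tendsto_intros lim)
  show "AE z in lborel. norm (std_normal_density z * h n (x n + sqrt (2 * t n) * z))
      \<le> C * std_normal_density z" for n
    using bdd by (intro AE_I2) (simp add: abs_mult mult.commute[of C] mult_left_mono)
qed auto

lemma continuous_on_gauss_mean:
  assumes "continuous_on UNIV h" "\<And>y. \<bar>h y\<bar> \<le> C"
  shows "continuous_on A (\<lambda>(x, t). gauss_mean h x t)"
proof (rule continuous_on_sequentiallyI)
  fix p :: "nat \<Rightarrow> real \<times> real" and P assume "p \<longlonglongrightarrow> P"
  have "isCont h y" for y using assms(1) by (simp add: continuous_on_eq_continuous_at)
  then show "(\<lambda>n. case p n of (x, t) \<Rightarrow> gauss_mean h x t) \<longlonglongrightarrow> (case P of (x, t) \<Rightarrow> gauss_mean h x t)"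
    unfolding case_prod_unfold using assms \<open>p \<longlonglongrightarrow> P\<close>
    by (intro gauss_mean_tendsto[where C = C] isCont_tendsto_compose[of _ h] tendsto_intros) auto
qed

lemma abs_gauss_mean_le:
  assumes [measurable]: "h \<in> borel_measurable borel" and h: "\<And>y. \<bar>h y\<bar> \<le> C"
  shows "\<bar>gauss_mean h x t\<bar> \<le> C"
proof -
  have le: "norm (std_normal_density z * h (x + sqrt (2 * t) * z)) \<le> C * std_normal_density z" for z
    using h by (simp add: abs_mult mult.commute[of C] mult_left_mono)
  have "integrable lborel (\<lambda>z. std_normal_density z * h (x + sqrt (2 * t) * z))"
    by (rule Bochner_Integration.integrable_bound[of _ "\<lambda>z. C * std_normal_density z"])
      (use le in \<open>auto intro: order_trans[OF _ abs_ge_self]\<close>)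
  then have "norm (gauss_mean h x t) \<le> (LINT z|lborel. C * std_normal_density z)"
    unfolding gauss_mean_def by (rule Bochner_Integration.integral_norm_bound_integral) (use le in auto)
  then show ?thesis by simp
qed

lemma gauss_mean_0 [simp]: "gauss_mean h x 0 = h x"
  by (simp add: gauss_mean_def)

lemma gauss_mean_eq_potential:
  assumes h: "continuous_on UNIV h" "\<And>y. y \<notin> {a..b} \<Longrightarrow> h y = 0" and t: "t > 0"
  shows "gauss_mean h x t = integral {a..b} (\<lambda>y. heat_kernel (x - y) t * h y)"
proof -
  have "set_integrable lborel {a..b} (\<lambda>y. heat_kernel (x - y) t * h y)"
    by (intro borel_integrable_atLeastAtMost' continuous_intros continuous_on_subset[OF h(1)])
      (use t in auto)
  from set_borel_integral_eq_integral(2)[OF this]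
  have "integral {a..b} (\<lambda>y. heat_kernel (x - y) t * h y) = (LINT y|lborel. heat_kernel (x - y) t * h y)"
    unfolding set_lebesgue_integral_def
    by (subst (asm) Bochner_Integration.integral_cong[OF refl, of _ _ "\<lambda>y. heat_kernel (x - y) t * h y"])
      (use h(2) in \<open>auto simp: indicator_def\<close>)
  also have "\<dots> = (LINT z|lborel. sqrt (2 * t) *
      (heat_kernel (x - (x + sqrt (2 * t) * z)) t * h (x + sqrt (2 * t) * z)))"
    using t by (subst lborel_integral_real_affine[where c = "sqrt (2 * t)" and t = x]) auto
  also have "\<dots> = gauss_mean h x t"
    unfolding gauss_mean_def
  proof (rule Bochner_Integration.integral_cong)
    fix z
    have "sqrt (2 * t) * heat_kernel (x - (x + sqrt (2 * t) * z)) t = std_normal_density z"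
    proof -
      have "sqrt (4 * pi * t) = sqrt (2 * t) * sqrt (2 * pi)"
        by (simp flip: real_sqrt_mult)
      then show ?thesis
        using t by (simp add: heat_kernel_def std_normal_density_def power_mult_distrib)
    qed
    then show "sqrt (2 * t) * (heat_kernel (x - (x + sqrt (2 * t) * z)) t * h (x + sqrt (2 * t) * z))
      = std_normal_density z * h (x + sqrt (2 * t) * z)"
      by (metis mult.assoc)
  qed simp
  finally show ?thesis by simp
qed

text \<open>The data are cut off continuously outside \<open>[- m, m]\<close>. The solution with the truncated data
  agrees with \<open>u\<close> at time \<open>0\<close> on \<open>[- m, m]\<close> and both are bounded, so the comparison on the
  rectangle makes their distance at a fixed point tend to \<open>0\<close> as \<open>m \<rightarrow> \<infinity>\<close>.\<close>
theorem bounded_heat_solution_eq_gauss_mean: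
  assumes f: "continuous_on UNIV f" "\<And>x. \<bar>f x\<bar> \<le> C"
    and u: "\<And>x t. t > 0 \<Longrightarrow> heat_defect_at u x t 0"
    "continuous_on (UNIV \<times> {0..}) (\<lambda>(x, t). u x t)"
    "\<And>x t. t > 0 \<Longrightarrow> \<bar>u x t\<bar> \<le> C" "\<And>x. u x 0 = f x"
    and t: "t \<ge> 0"
  shows "u x t = gauss_mean f x t"
proof -
  have "C \<ge> 0" using f(2)[of 0] by simp
  define h where "h = (\<lambda>m y. max 0 (min 1 (m + 1 - \<bar>y\<bar>)) * f y)"
  have h_cont: "continuous_on UNIV (h m)" for m
    unfolding h_def by (intro continuous_intros f(1))
  have h_bdd: "\<bar>h m y\<bar> \<le> C" for m y
  proof -
    have "\<bar>h m y\<bar> \<le> 1 * C"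
      unfolding h_def abs_mult by (intro mult_mono f(2)) auto
    then show ?thesis by simp
  qed
  have h_eq: "h m y = f y" if "\<bar>y\<bar> \<le> m" for m y using that by (simp add: h_def)
  have approx: "\<bar>u x t - gauss_mean (h m) x t\<bar> \<le> (2 * C + 1) * (x\<^sup>2 + 3 * t) / m\<^sup>2"
    if m: "m > 0" "\<bar>x\<bar> \<le> m" for m
  proof -
    have defect: "heat_defect_at (gauss_mean (h m)) y s 0" if "s > 0" for y s
    proof (rule heat_defect_at_cong[OF heat_potential_defect])
      show "continuous_on {- (m + 1)..m + 1} (h m)" by (rule continuous_on_subset[OF h_cont]) auto
      show "integral {- (m + 1)..m + 1} (\<lambda>y. heat_kernel (x - y) t * h m y) = gauss_mean (h m) x t"
        if "t > 0" for x t
        by (rule gauss_mean_eq_potential[symmetric, OF h_cont]) (use that in \<open>auto simp: h_def\<close>)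
    qed (use that in auto)
    \<comment> \<open>The sign \<open>\<sigma> = 1\<close> or \<open>\<sigma> = - 1\<close> gives the upper and the lower estimate at once.\<close>
    have diff: "\<sigma> * u x t + (- \<sigma>) * gauss_mean (h m) x t \<le> (2 * C + 1) * (x\<^sup>2 + 3 * t) / m\<^sup>2"
      if "\<bar>\<sigma>\<bar> = 1" for \<sigma> :: real
    proof (rule comparison_on_rectangle[where T = t])
      have "continuous_on ({-m..m} \<times> {0..t}) (\<lambda>(x, t). u x t)"
        by (rule continuous_on_subset[OF u(2)]) auto
      then show "continuous_on ({-m..m} \<times> {0..t}) (\<lambda>(x, t). \<sigma> * u x t + (- \<sigma>) * gauss_mean (h m) x t)"
        using continuous_on_gauss_mean[OF h_cont[of m] h_bdd, of "{-m..m} \<times> {0..t}"]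
        by (auto simp: case_prod_unfold intro!: continuous_intros)
      show "heat_defect_at (\<lambda>x t. \<sigma> * u x t + (- \<sigma>) * gauss_mean (h m) x t) y s 0" if "s > 0" for y s
        using heat_defect_at_lincomb[OF u(1)[OF that, of y] defect[OF that], of \<sigma> "-\<sigma>"] by simp
      show "\<sigma> * u y s + (- \<sigma>) * gauss_mean (h m) y s \<le> 2 * C + 1" if "s > 0" for y s
      proof -
        have "\<bar>\<sigma> * u y s\<bar> \<le> C" "\<bar>(- \<sigma>) * gauss_mean (h m) y s\<bar> \<le> C"
          using u(3)[OF that] abs_gauss_mean_le[OF borel_measurable_continuous_onI[OF h_cont] h_bdd] \<open>\<bar>\<sigma>\<bar> = 1\<close> by (auto simp: abs_mult)
        then show ?thesis by linarith
      qed
      show "\<sigma> * u y 0 + (- \<sigma>) * gauss_mean (h m) y 0 \<le> 0" if "\<bar>y\<bar> \<le> m" for y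
        using that by (simp add: h_eq u(4))
    qed (use m t \<open>C \<ge> 0\<close> in auto)
    from diff[of 1] diff[of "-1"] show ?thesis by (simp add: abs_le_iff)
  qed
  have "(\<lambda>n. gauss_mean (h (real n)) x t) \<longlonglongrightarrow> gauss_mean f x t"
  proof (rule gauss_mean_tendsto[OF h_cont f(1) h_bdd])
    fix z
    have "\<forall>\<^sub>F n in sequentially. \<bar>x + sqrt (2 * t) * z\<bar> \<le> real n"
      using eventually_ge_at_top[of "nat \<lceil>\<bar>x + sqrt (2 * t) * z\<bar>\<rceil>"]
      by eventually_elim linarith
    then have "\<forall>\<^sub>F n in sequentially. h (real n) (x + sqrt (2 * t) * z) = f (x + sqrt (2 * t) * z)"
      by eventually_elim (rule h_eq)
    then show "(\<lambda>n. h (real n) (x + sqrt (2 * t) * z)) \<longlonglongrightarrow> f (x + sqrt (2 * t) * z)"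
      by (rule tendsto_eventually)
  qed
  moreover have "(\<lambda>n. gauss_mean (h (real n)) x t) \<longlonglongrightarrow> u x t"
  proof (rule Lim_null_comparison[THEN Lim_null[THEN iffD2]])
    show "\<forall>\<^sub>F n in sequentially. norm (gauss_mean (h (real n)) x t - u x t)
        \<le> (2 * C + 1) * (x\<^sup>2 + 3 * t) / (real n)\<^sup>2"
      using eventually_gt_at_top[of "nat \<lceil>\<bar>x\<bar>\<rceil>"]
    proof eventually_elim
      case (elim n)
      then have "real n > 0" "\<bar>x\<bar> \<le> real n" by linarith+
      from approx[OF this] show ?case by (simp add: abs_minus_commute)
    qed
    show "(\<lambda>n. (2 * C + 1) * (x\<^sup>2 + 3 * t) / (real n)\<^sup>2) \<longlonglongrightarrow> 0"
      by real_asymp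
  qed
  ultimately show ?thesis by (rule LIMSEQ_unique[symmetric])
qed

section \<open>Entire functions with Gaussian decay on a ray\<close>

text \<open>Phragmen-Lindelof principle: growth \<open>exp (D exp (2 \<bar>Re z\<bar>))\<close> is admissible in a strip of width
  \<open>2 h < \<pi> / 2\<close>. Indeed \<open>2 < p < \<pi> / (2 h)\<close> for a suitable \<open>p\<close>, and the factor
  \<open>exp (- \<epsilon> E)\<close>, with \<open>E z\<close> twice the hyperbolic cosine of \<open>p (z - \<i> \<gamma>)\<close>, damps this growth
  at both ends of the strip. The maximum modulus principle then applies on a long rectangle.\<close>
theorem phragmen_lindelof_strip:
  fixes G :: "complex \<Rightarrow> complex"
  assumes hol: "G holomorphic_on UNIV" and h: "0 < h" "h < pi / 4"
    and growth: "\<And>z. \<bar>Im z - \<gamma>\<bar> \<le> h \<Longrightarrow> norm (G z) \<le> A * exp (D * exp (2 * \<bar>Re z\<bar>))"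
    and edge: "\<And>z. \<bar>Im z - \<gamma>\<bar> = h \<Longrightarrow> norm (G z) \<le> B"
    and "A > 0" "B > 0" and w: "\<bar>Im w - \<gamma>\<bar> \<le> h"
  shows "norm (G w) \<le> B"
proof -
  \<comment> \<open>The midpoint of \<open>2\<close> and \<open>\<pi> / (2 h)\<close>.\<close>
  define p where "p = (2 + pi / (2 * h)) / 2"
  have p: "p > 2" "p * h < pi / 2" "p * h > 0"
  proof -
    have "p * h = h + pi / 4" using h by (simp add: p_def field_simps)
    then show "p * h < pi / 2" "p * h > 0" using h by auto
    show "p > 2" using h by (simp add: p_def field_simps)
  qed
  define \<kappa> where "\<kappa> = cos (p * h)"
  have "\<kappa> > 0" unfolding \<kappa>_def using p by (intro cos_gt_zero) auto
  define E where "E = (\<lambda>z. exp (of_real p * (z - \<i> * of_real \<gamma>)) + exp (- (of_real p * (z - \<i> * of_real \<gamma>))))"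
  have E_hol: "E holomorphic_on UNIV" unfolding E_def by (intro holomorphic_intros)
  have E_ge: "Re (E z) \<ge> \<kappa> * exp (p * \<bar>Re z\<bar>)" if "\<bar>Im z - \<gamma>\<bar> \<le> h" for z
  proof -
    have "\<kappa> \<le> cos \<bar>p * (Im z - \<gamma>)\<bar>"
      unfolding \<kappa>_def using that p h
      by (intro cos_monotone_0_pi_le) (auto simp: abs_mult intro!: mult_left_mono)
    then have *: "\<kappa> \<le> cos (p * (Im z - \<gamma>))" by simp
    have "Re (E z) = exp (p * Re z) * cos (p * (Im z - \<gamma>)) + exp (- (p * Re z)) * cos (p * (Im z - \<gamma>))"
      by (simp add: E_def Re_exp)
    also have "\<dots> = (exp (p * Re z) + exp (- (p * Re z))) * cos (p * (Im z - \<gamma>))"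
      by (simp add: distrib_right)
    also have "\<dots> \<ge> exp (p * \<bar>Re z\<bar>) * \<kappa>"
      using * \<open>\<kappa> > 0\<close> by (intro mult_mono) (auto simp: abs_if)
    finally show ?thesis by (simp add: mult.commute)
  qed
  have damped: "norm (G w) * exp (- \<epsilon> * Re (E w)) \<le> B" if "\<epsilon> > 0" for \<epsilon>
  proof -
    define H where "H = (\<lambda>z. G z * exp (- of_real \<epsilon> * E z))"
    have norm_H: "norm (H z) = norm (G z) * exp (- \<epsilon> * Re (E z))" for z
      by (simp add: H_def norm_mult)
    have "\<forall>\<^sub>F L in at_top. A * exp (D * exp (2 * L) - \<epsilon> * \<kappa> * exp (p * L)) \<le> B"
    proof -
      have "((\<lambda>L. A * exp (D * exp (2 * L) - \<epsilon> * \<kappa> * exp (p * L))) \<longlongrightarrow> 0) at_top"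
      proof -
        define q where "q = p - 2"
        have "q > 0" "p = 2 + q" using p by (auto simp: q_def)
        then show ?thesis using that \<open>\<kappa> > 0\<close> \<open>A > 0\<close> by real_asymp
      qed
      from order_tendstoD(2)[OF this \<open>B > 0\<close>] show ?thesis
        by (rule eventually_mono) simp
    qed
    moreover have "\<forall>\<^sub>F L in at_top. L \<ge> \<bar>Re w\<bar> + 1" by (rule eventually_ge_at_top)
    ultimately have "\<forall>\<^sub>F L in at_top. A * exp (D * exp (2 * L) - \<epsilon> * \<kappa> * exp (p * L)) \<le> B \<and> L \<ge> \<bar>Re w\<bar> + 1"
      by (rule eventually_conj)
    then obtain L where L: "A * exp (D * exp (2 * L) - \<epsilon> * \<kappa> * exp (p * L)) \<le> B"
      "L \<ge> \<bar>Re w\<bar> + 1"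
      using eventually_happens'[OF trivial_limit_at_top_linorder] by blast
    define S where "S = cbox (Complex (- L) (\<gamma> - h)) (Complex L (\<gamma> + h))"
    have "norm (H w) \<le> B"
    proof (rule maximum_modulus_frontier[of H S])
      have "H holomorphic_on UNIV"
        unfolding H_def by (intro holomorphic_intros hol E_hol)
      then show "H holomorphic_on interior S" "continuous_on (closure S) H"
        by (auto intro: holomorphic_on_subset holomorphic_on_imp_continuous_on)
      show "bounded S" by (simp add: S_def)
      show "w \<in> S" using w L(2) by (auto simp: S_def in_cbox_complex_iff)
    next
      fix z assume "z \<in> frontier S"
      then have "z \<in> cbox (Complex (- L) (\<gamma> - h)) (Complex L (\<gamma> + h))"
        "z \<notin> box (Complex (- L) (\<gamma> - h)) (Complex L (\<gamma> + h))"
        by (auto simp: S_def frontier_def interior_cbox)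
      then have z: "\<bar>Im z - \<gamma>\<bar> \<le> h" "\<bar>Im z - \<gamma>\<bar> = h \<or> \<bar>Re z\<bar> = L"
        by (auto simp: in_cbox_complex_iff in_box_complex_iff)
      have pos: "Re (E z) \<ge> 0"
        using E_ge[OF z(1)] \<open>\<kappa> > 0\<close> by (meson exp_gt_zero less_imp_le mult_nonneg_nonneg order_trans)
      show "norm (H z) \<le> B"
      proof (cases "\<bar>Im z - \<gamma>\<bar> = h")
        case True
        have "norm (H z) \<le> B * 1"
          unfolding norm_H using edge[OF True] pos that \<open>B > 0\<close>
          by (intro mult_mono) auto
        then show ?thesis by simp
      next
        case False
        then have "\<bar>Re z\<bar> = L" using z by simp
        have "norm (H z) \<le> (A * exp (D * exp (2 * L))) * exp (- \<epsilon> * (\<kappa> * exp (p * L)))"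
          unfolding norm_H using growth[OF z(1)] E_ge[OF z(1)] that \<open>\<bar>Re z\<bar> = L\<close> \<open>A > 0\<close>
          by (intro mult_mono) auto
        also have "\<dots> = A * exp (D * exp (2 * L) - \<epsilon> * \<kappa> * exp (p * L))"
          by (simp add: exp_diff exp_minus field_simps)
        finally show ?thesis using L(1) by simp
      qed
    qed
    then show ?thesis by (simp add: norm_H)
  qed
  have "((\<lambda>\<epsilon>. norm (G w) * exp (- \<epsilon> * Re (E w))) \<longlongrightarrow> norm (G w) * exp (- 0 * Re (E w))) (at_right 0)"
    by (intro tendsto_intros)
  then have "((\<lambda>\<epsilon>. norm (G w) * exp (- \<epsilon> * Re (E w))) \<longlongrightarrow> norm (G w)) (at_right 0)"
    by simp
  then show ?thesis
    by (rule tendsto_upperbound) (use damped in \<open>auto simp: eventually_at_right_less eventually_at_filter\<close>)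
qed

text \<open>The exponential maps a strip onto a sector; the vertex corresponds to the left end of the strip,
  where the damping factor of the strip version is effective as well.\<close>
theorem phragmen_lindelof_sector_order_2:
  fixes \<phi> :: "complex \<Rightarrow> complex"
  assumes hol: "\<phi> holomorphic_on UNIV"
    and growth: "\<And>z. norm (\<phi> z) \<le> A * exp (D * (norm z)\<^sup>2)" "A > 0" "D \<ge> 0"
    and sector: "\<alpha> < \<beta>" "\<beta> - \<alpha> < pi / 2"
    and rays: "\<And>r. r > 0 \<Longrightarrow> norm (\<phi> (rcis r \<alpha>)) \<le> B" "\<And>r. r > 0 \<Longrightarrow> norm (\<phi> (rcis r \<beta>)) \<le> B"
    and "B > 0" "\<alpha> \<le> \<theta>" "\<theta> \<le> \<beta>" "r > 0"
  shows "norm (\<phi> (rcis r \<theta>)) \<le> B"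
proof -
  have exp_eq: "exp z = rcis (exp (Re z)) (Im z)" for z
    by (simp add: exp_eq_polar rcis_def)
  have "norm ((\<phi> \<circ> exp) (Complex (ln r) \<theta>)) \<le> B"
  proof (rule phragmen_lindelof_strip[where \<gamma> = "(\<alpha> + \<beta>) / 2" and h = "(\<beta> - \<alpha>) / 2" and A = A and D = D and G = "\<phi> \<circ> exp"])
    show "(\<phi> \<circ> exp) holomorphic_on UNIV"
      by (intro holomorphic_on_compose holomorphic_intros holomorphic_on_subset[OF hol]) auto
    show "norm ((\<phi> \<circ> exp) z) \<le> A * exp (D * exp (2 * \<bar>Re z\<bar>))" for z
    proof -
      have "norm ((\<phi> \<circ> exp) z) \<le> A * exp (D * (exp (Re z))\<^sup>2)"
        using growth(1)[of "exp z"] by simp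
      also have "\<dots> \<le> A * exp (D * exp (2 * \<bar>Re z\<bar>))"
        using growth(2,3) by (auto simp flip: exp_double intro!: mult_left_mono)
      finally show ?thesis .
    qed
    show "norm ((\<phi> \<circ> exp) z) \<le> B" if "\<bar>Im z - (\<alpha> + \<beta>) / 2\<bar> = (\<beta> - \<alpha>) / 2" for z
    proof -
      have "Im z = \<alpha> \<or> Im z = \<beta>" using that by (auto simp: abs_if field_simps split: if_splits)
      then show ?thesis using rays[of "exp (Re z)"] by (auto simp: exp_eq)
    qed
  qed (use assms in \<open>auto simp: abs_if field_simps\<close>)
  then show ?thesis using \<open>r > 0\<close> by (simp add: exp_eq)
qed

text \<open>A theorem of Carlson type for order \<open>2\<close>. In the sector of angles from \<open>0\<close> to \<open>\<pi> / 4\<close>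
  the decay on the real axis interpolates with the growth on the diagonal (\<open>step1\<close>). Close to the
  real axis this leaves decay \<open>exp (- c r\<^sup>2)\<close> up to a small loss, whereas \<open>\<Psi>\<close> is bounded on
  the imaginary axis. Interpolating between these two rays, whose angle \<open>\<pi> / 2 - \<theta>\<close> is just below
  the critical \<open>\<pi> / 2\<close>, gives decay \<open>exp (- K Im (z\<^sup>2))\<close> with
  \<open>K = c / tan (2 \<theta>) - D\<close> (\<open>step2\<close>). As \<open>\<theta> \<rightarrow> 0\<close> the rate \<open>K\<close> is unbounded, while the
  constant \<open>M\<close> stays the same, so \<open>\<Psi>\<close> vanishes on the diagonal.\<close>
theorem entire_gaussian_decay_imp_zero:
  fixes \<Psi> :: "complex \<Rightarrow> complex"
  assumes hol: "\<Psi> holomorphic_on UNIV"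
    and growth: "\<And>z. norm (\<Psi> z) \<le> A * exp (D * (Re z)\<^sup>2)" "A > 0" "D \<ge> 0"
    and decay: "\<And>s. s > 0 \<Longrightarrow> norm (\<Psi> (of_real s)) \<le> B * exp (- c * s\<^sup>2)" "B > 0" "c > 0"
  shows "\<Psi> z = 0"
proof -
  define M where "M = max A B"
  have M: "M > 0" "A \<le> M" "B \<le> M" using growth decay by (auto simp: M_def)
  have sq: "(rcis r \<theta>)\<^sup>2 = rcis (r\<^sup>2) (2 * \<theta>)" for r \<theta>
    by (simp add: DeMoivre2)
  have Re_Im_le: "\<bar>Re (k * z\<^sup>2)\<bar> \<le> norm k * (norm z)\<^sup>2" for k z
    using abs_Re_le_cmod[of "k * z\<^sup>2"] by (simp add: norm_mult norm_power)
  have growth': "norm (\<Psi> z * exp (k * z\<^sup>2)) \<le> A * exp ((D + norm k) * (norm z)\<^sup>2)" for k z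
  proof -
    have "norm (\<Psi> z * exp (k * z\<^sup>2)) \<le> A * exp (D * (Re z)\<^sup>2) * exp (Re (k * z\<^sup>2))"
      unfolding norm_mult norm_exp_eq_Re by (intro mult_right_mono growth) auto
    also have "\<dots> \<le> A * exp (D * (norm z)\<^sup>2) * exp (norm k * (norm z)\<^sup>2)"
      using growth(2,3) Re_Im_le[of k z]
      by (intro mult_mono) (auto intro!: mult_left_mono simp: abs_Re_le_cmod abs_le_square_iff[symmetric])
    finally show ?thesis by (simp add: exp_add distrib_right mult.assoc)
  qed
  have le_exp: "a \<le> M * exp (- x)" if "a * exp x \<le> M" for a x
    using that by (simp add: exp_minus field_simps)
  have step1: "norm (\<Psi> (rcis r \<theta>)) \<le> M * exp (r\<^sup>2 * (D * sin (2 * \<theta>) - c * cos (2 * \<theta>)))"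
    if "0 \<le> \<theta>" "\<theta> \<le> pi / 4" "r > 0" for r \<theta>
  proof -
    \<comment> \<open>The factor \<open>exp ((c + \<i> D) z\<^sup>2)\<close> has modulus \<open>exp (c r\<^sup>2)\<close> on the real axis and
      \<open>exp (- D r\<^sup>2)\<close> on the diagonal, which compensates decay and growth there.\<close>
    define k where "k = Complex c D"
    have Re_k: "Re (k * (rcis r \<theta>)\<^sup>2) = r\<^sup>2 * (c * cos (2 * \<theta>) - D * sin (2 * \<theta>))" for r \<theta>
      by (simp add: sq k_def algebra_simps)
    have "norm (\<Psi> (rcis r \<theta>) * exp (k * (rcis r \<theta>)\<^sup>2)) \<le> M"
    proof (rule phragmen_lindelof_sector_order_2[where \<phi> = "\<lambda>z. \<Psi> z * exp (k * z\<^sup>2)" and \<alpha> = 0 and \<beta> = "pi / 4"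
          and D = "D + norm k" and A = A])
      show "(\<lambda>z. \<Psi> z * exp (k * z\<^sup>2)) holomorphic_on UNIV" by (intro holomorphic_intros hol)
      show "norm (\<Psi> z * exp (k * z\<^sup>2)) \<le> A * exp ((D + norm k) * (norm z)\<^sup>2)" for z
        by (rule growth')
      show "norm (\<Psi> (rcis r 0) * exp (k * (rcis r 0)\<^sup>2)) \<le> M" if "r > 0" for r
      proof -
        have "norm (\<Psi> (rcis r 0) * exp (k * (rcis r 0)\<^sup>2)) \<le> B * exp (- c * r\<^sup>2) * exp (c * r\<^sup>2)"
          unfolding norm_mult norm_exp_eq_Re Re_k using decay(1)[OF that] by (simp add: mult.commute)
        then show ?thesis using M by (simp add: exp_minus field_simps)
      qed
      show "norm (\<Psi> (rcis r (pi / 4)) * exp (k * (rcis r (pi / 4))\<^sup>2)) \<le> M" if "r > 0" for r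
      proof -
        have "(Re (rcis r (pi / 4)))\<^sup>2 = r\<^sup>2 / 2"
          by (simp add: cos_45 power_mult_distrib power_divide)
        also have "\<dots> \<le> r\<^sup>2" by simp
        finally have "D * (Re (rcis r (pi / 4)))\<^sup>2 \<le> D * r\<^sup>2" using growth(3) by (intro mult_left_mono)
        then have "norm (\<Psi> (rcis r (pi / 4))) \<le> A * exp (D * r\<^sup>2)"
          using growth(1)[of "rcis r (pi / 4)"] growth(2)
          by (meson exp_le_cancel_iff less_imp_le mult_left_mono order_trans)
        then have "norm (\<Psi> (rcis r (pi / 4)) * exp (k * (rcis r (pi / 4))\<^sup>2)) \<le> A * exp (D * r\<^sup>2) * exp (- (D * r\<^sup>2))"
          unfolding norm_mult norm_exp_eq_Re Re_k by (simp add: mult.commute)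
        then show ?thesis using M by (simp add: exp_minus field_simps)
      qed
    qed (use that growth M in auto)
    from le_exp[OF this[unfolded norm_mult norm_exp_eq_Re Re_k]] show ?thesis
      by (simp add: algebra_simps)
  qed
  have step2: "norm (\<Psi> (rcis r (pi / 4))) \<le> M * exp (- K * r\<^sup>2)" if "K > 0" "r > 0" for K r
  proof -
    \<comment> \<open>The angle for which the formula \<open>K = c / tan (2 \<theta>) - D\<close> yields the given rate.\<close>
    define \<theta> where "\<theta> = arctan (c / (K + D)) / 2"
    have KD: "K + D > 0" using that growth(3) by simp
    have "0 < c / (K + D)" using KD decay(3) by simp
    then have \<theta>: "0 < \<theta>" "\<theta> < pi / 4"
      unfolding \<theta>_def using arctan_ubound[of "c / (K + D)"] by auto
    have "cos (2 * \<theta>) > 0" using \<theta> by (intro cos_gt_zero) auto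
    moreover have "tan (2 * \<theta>) = c / (K + D)" by (simp add: \<theta>_def tan_arctan)
    ultimately have *: "K * sin (2 * \<theta>) = c * cos (2 * \<theta>) - D * sin (2 * \<theta>)"
      using KD by (simp add: tan_def field_simps)
    \<comment> \<open>The factor \<open>exp (- \<i> K z\<^sup>2)\<close> has modulus \<open>exp (K Im (z\<^sup>2))\<close>: it is \<open>1\<close> on the imaginary
      axis, and on the ray of angle \<open>\<theta>\<close> it cancels the bound of \<open>step1\<close> exactly.\<close>
    define k where "k = - \<i> * of_real K"
    have Re_k: "Re (k * (rcis r \<theta>)\<^sup>2) = K * r\<^sup>2 * sin (2 * \<theta>)" for r \<theta>
      by (simp add: sq k_def algebra_simps)
    have "norm (\<Psi> (rcis r (pi / 4)) * exp (k * (rcis r (pi / 4))\<^sup>2)) \<le> M"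
    proof (rule phragmen_lindelof_sector_order_2[where \<phi> = "\<lambda>z. \<Psi> z * exp (k * z\<^sup>2)" and \<alpha> = \<theta> and \<beta> = "pi / 2"
          and D = "D + norm k" and A = A])
      show "(\<lambda>z. \<Psi> z * exp (k * z\<^sup>2)) holomorphic_on UNIV" by (intro holomorphic_intros hol)
      show "norm (\<Psi> z * exp (k * z\<^sup>2)) \<le> A * exp ((D + norm k) * (norm z)\<^sup>2)" for z
        by (rule growth')
      show "norm (\<Psi> (rcis r \<theta>) * exp (k * (rcis r \<theta>)\<^sup>2)) \<le> M" if "r > 0" for r
      proof -
        have "K * r\<^sup>2 * sin (2 * \<theta>) = - (r\<^sup>2 * (D * sin (2 * \<theta>) - c * cos (2 * \<theta>)))"
          using arg_cong[OF *, of "\<lambda>s. r\<^sup>2 * s"] by (simp add: algebra_simps)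
        then have "norm (\<Psi> (rcis r \<theta>) * exp (k * (rcis r \<theta>)\<^sup>2))
            \<le> M * exp (r\<^sup>2 * (D * sin (2 * \<theta>) - c * cos (2 * \<theta>))) * exp (- (r\<^sup>2 * (D * sin (2 * \<theta>) - c * cos (2 * \<theta>))))"
          unfolding norm_mult norm_exp_eq_Re Re_k using step1[of \<theta> r] \<theta> that by (metis exp_ge_zero less_imp_le mult_right_mono)
        also have "\<dots> = M" by (simp add: mult.assoc exp_minus_inverse)
        finally show ?thesis .
      qed
      show "norm (\<Psi> (rcis r (pi / 2)) * exp (k * (rcis r (pi / 2))\<^sup>2)) \<le> M" if "r > 0" for r
        unfolding norm_mult norm_exp_eq_Re Re_k using growth(1)[of "rcis r (pi / 2)"] M by simp
    qed (use that \<theta> growth M in auto)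
    from le_exp[OF this[unfolded norm_mult norm_exp_eq_Re Re_k]] show ?thesis
      by simp
  qed
  have zero: "\<Psi> (rcis r (pi / 4)) = 0" if "r > 0" for r
  proof -
    have "((\<lambda>K. M * exp (- K * r\<^sup>2)) \<longlongrightarrow> 0) at_top" using that by real_asymp
    then have "norm (\<Psi> (rcis r (pi / 4))) \<le> 0"
      by (rule tendsto_lowerbound)
        (rule eventually_mono[OF eventually_gt_at_top[of 0] step2[OF _ that]], auto)
    then show ?thesis by simp
  qed
  show ?thesis
  proof (rule analytic_continuation[OF hol, where U = "(\<lambda>r. rcis r (pi / 4)) ` {0<..}" and \<xi> = 0])
    show "0 islimpt (\<lambda>r. rcis r (pi / 4)) ` {0<..}"
      unfolding islimpt_approachable
    proof (intro allI impI)
      fix e :: real assume "e > 0"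
      then show "\<exists>x'\<in>(\<lambda>r. rcis r (pi / 4)) ` {0<..}. x' \<noteq> 0 \<and> dist x' 0 < e"
        by (intro bexI[of _ "rcis (e / 2) (pi / 4)"] imageI) auto
    qed
  qed (use zero in auto)
qed

section \<open>The Laplace transform with Gaussian weight\<close>

definition gauss_laplace :: "(real \<Rightarrow> real) \<Rightarrow> complex \<Rightarrow> complex" where
  "gauss_laplace h z = (LINT y|lborel. of_real (std_normal_density y * h y) * exp (z * of_real y))"

lemma std_normal_density_tilt:
  "std_normal_density y * exp (r * y) = exp (r\<^sup>2 / 2) * normal_density r 1 y"
proof -
  have "- y\<^sup>2 / 2 + r * y = r\<^sup>2 / 2 + - (y - r)\<^sup>2 / 2"
    by (simp add: power2_eq_square field_simps)
  then show ?thesis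
    by (simp add: std_normal_density_def normal_density_def flip: exp_add)
qed

context
  fixes h :: "real \<Rightarrow> real" and C :: real
  assumes h_cont: "continuous_on UNIV h" and h_bdd: "\<And>y. \<bar>h y\<bar> \<le> C"
begin

lemma h_measurable [measurable]: "h \<in> borel_measurable borel"
  by (rule borel_measurable_continuous_onI[OF h_cont])

lemma norm_gauss_laplace_integrand_le:
  "norm (of_real (std_normal_density y * h y) * exp (z * of_real y))
     \<le> C * (exp ((Re z)\<^sup>2 / 2) * normal_density (Re z) 1 y)"
proof -
  have "norm (of_real (std_normal_density y * h y) * exp (z * of_real y))
      = \<bar>h y\<bar> * (std_normal_density y * exp (Re z * y))"
    by (simp add: norm_mult abs_mult)
  also have "\<dots> \<le> C * (std_normal_density y * exp (Re z * y))"
    by (intro mult_right_mono h_bdd) auto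
  finally show ?thesis by (simp add: std_normal_density_tilt)
qed

lemma integrable_gauss_laplace:
  "integrable lborel (\<lambda>y. of_real (std_normal_density y * h y) * exp (z * of_real y) :: complex)"
  by (rule Bochner_Integration.integrable_bound[of _ "\<lambda>y. C * (exp ((Re z)\<^sup>2 / 2) * normal_density (Re z) 1 y)"])
    (use norm_gauss_laplace_integrand_le[of _ z] in \<open>auto intro: order_trans[OF _ abs_ge_self]\<close>)

lemma norm_gauss_laplace_le: "norm (gauss_laplace h z) \<le> C * exp ((Re z)\<^sup>2 / 2)"
proof -
  have "norm (gauss_laplace h z) \<le> (LINT y|lborel. C * (exp ((Re z)\<^sup>2 / 2) * normal_density (Re z) 1 y))"
    unfolding gauss_laplace_def
    by (rule Bochner_Integration.integral_norm_bound_integral[OF integrable_gauss_laplace])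
      (use norm_gauss_laplace_integrand_le[of _ z] in auto)
  then show ?thesis by simp
qed

text \<open>The transform is a locally uniform limit of integrals over compact intervals. The tail is
  controlled uniformly for \<open>\<bar>Re z\<bar> \<le> R\<close> because \<open>exp (Re z * y) \<le> exp (R y) + exp (- R y)\<close>.\<close>
lemma gauss_laplace_holomorphic: "gauss_laplace h holomorphic_on UNIV"
proof (rule holomorphic_uniform_sequence)
  let ?F = "\<lambda>z y. of_real (std_normal_density y * h y) * exp (z * of_real y) :: complex"
  let ?I = "\<lambda>n::nat. cbox (- real n) (real n)"
  have cont: "continuous_on A (\<lambda>(z, y). of_real (std_normal_density y * h y) * of_real y ^ k * exp (z * of_real y) :: complex)"
    for A :: "(complex \<times> real) set" and k
    unfolding case_prod_unfold normal_density_def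
    by (intro continuous_intros continuous_on_compose2[OF h_cont]) auto
  have cont1: "continuous_on A (?F z)" for A z
    unfolding normal_density_def
    by (intro continuous_intros continuous_on_subset[OF h_cont]) auto
  show "(\<lambda>z. integral (?I n) (?F z)) holomorphic_on UNIV" for n
  proof (rule leibniz_rule_holomorphic)
    show "((\<lambda>z. ?F z y) has_field_derivative of_real (std_normal_density y * h y) * of_real y ^ 1 * exp (z * of_real y))
        (at z within UNIV)" for z y
      by (auto intro!: derivative_eq_intros)
    show "?F z integrable_on ?I n" for z by (intro integrable_continuous cont1)
  qed (rule cont, auto)
  fix z0 :: complex
  define R where "R = \<bar>Re z0\<bar> + 1"
  define W where "W = (\<lambda>y. C * (exp (R\<^sup>2 / 2) * normal_density R 1 y) + C * (exp ((-R)\<^sup>2 / 2) * normal_density (-R) 1 y))"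
  have W_int: "integrable lborel W" unfolding W_def by auto
  have [measurable]: "W \<in> borel_measurable borel" using W_int by auto
  have W_ge: "norm (?F z y) \<le> W y" if "\<bar>Re z\<bar> \<le> R" for z y
  proof -
    have "C \<ge> 0" using h_bdd[of 0] by simp
    have "exp (Re z * y) \<le> exp (R * y) + exp (- R * y)"
    proof (cases "y \<ge> 0")
      case True
      then have "Re z * y \<le> R * y" using that by (intro mult_right_mono) auto
      then have "exp (Re z * y) \<le> exp (R * y)" by simp
      then show ?thesis using exp_gt_zero[of "- R * y"] by linarith
    next
      case False
      then have "Re z * y \<le> - R * y" using that by (intro mult_right_mono_neg) auto
      then have "exp (Re z * y) \<le> exp (- R * y)" by simp
      then show ?thesis using exp_gt_zero[of "R * y"] by linarith
    qed
    then have "C * (std_normal_density y * exp (Re z * y))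
       \<le> C * (std_normal_density y * (exp (R * y) + exp (- R * y)))"
      using \<open>C \<ge> 0\<close> by (intro mult_left_mono) auto
    also have "\<dots> = W y"
      unfolding W_def std_normal_density_tilt[symmetric] by (simp add: algebra_simps)
    finally show ?thesis
      using norm_gauss_laplace_integrand_le[of y z] by (simp add: std_normal_density_tilt)
  qed
  define tail where "tail = (\<lambda>n::nat. LINT y|lborel. indicator (- ?I n) y * W y)"
  have "tail \<longlonglongrightarrow> integral\<^sup>L lborel (\<lambda>_::real. 0)"
    unfolding tail_def
  proof (rule integral_dominated_convergence[where w = "\<lambda>y. \<bar>W y\<bar>" and f = "\<lambda>_. 0"])
    show "AE y in lborel. (\<lambda>n. indicator (- ?I n) y * W y) \<longlonglongrightarrow> 0"
    proof (rule AE_I2)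
      fix y :: real
      have "\<forall>\<^sub>F n in sequentially. y \<in> ?I n"
        using eventually_ge_at_top[of "nat \<lceil>\<bar>y\<bar>\<rceil>"] by eventually_elim (auto; linarith)
      then have "\<forall>\<^sub>F n in sequentially. indicator (- ?I n) y * W y = 0"
        by eventually_elim auto
      then show "(\<lambda>n. indicator (- ?I n) y * W y) \<longlonglongrightarrow> 0" by (rule tendsto_eventually)
    qed
  qed (use W_int in \<open>auto simp: indicator_def\<close>)
  then have tail: "tail \<longlonglongrightarrow> 0" by simp
  have tail_ge: "dist (integral (?I n) (?F z)) (gauss_laplace h z) \<le> tail n" if "\<bar>Re z\<bar> \<le> R" for n z
  proof -
    have set_int: "set_integrable lborel (?I n) (?F z)" "set_integrable lborel (- ?I n) (?F z)"
      using integrable_gauss_laplace[of z]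
      by (auto simp: set_integrable_def intro!: integrable_mult_indicator)
    have "gauss_laplace h z = (LINT y:?I n \<union> (- ?I n)|lborel. ?F z y)"
      by (simp add: gauss_laplace_def set_lebesgue_integral_def del: cbox_interval)
    also have "\<dots> = (LINT y:?I n|lborel. ?F z y) + (LINT y:- ?I n|lborel. ?F z y)"
      by (rule set_integral_Un[OF _ set_int]) auto
    also have "(LINT y:?I n|lborel. ?F z y) = integral (?I n) (?F z)"
      by (rule set_borel_integral_eq_integral(2)[OF set_int(1)])
    finally have "dist (integral (?I n) (?F z)) (gauss_laplace h z) = norm (LINT y:- ?I n|lborel. ?F z y)"
      by (simp add: dist_norm)
    also have "\<dots> \<le> tail n"
      unfolding set_lebesgue_integral_def tail_def
    proof (rule Bochner_Integration.integral_norm_bound_integral)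
      show "integrable lborel (\<lambda>y. indicator (- ?I n) y *\<^sub>R ?F z y)"
        using set_int(2) by (simp add: set_integrable_def)
      show "integrable lborel (\<lambda>y. indicator (- ?I n) y * W y)"
        using integrable_mult_indicator[OF _ W_int, of "- ?I n"] by simp
      show "norm (indicator (- ?I n) y *\<^sub>R ?F z y) \<le> indicator (- ?I n) y * W y" for y
        using W_ge[OF that, of y] by (auto simp: indicator_def)
    qed
    finally show ?thesis .
  qed
  have "uniform_limit (cball z0 1) (\<lambda>n z. integral (?I n) (?F z)) (gauss_laplace h) sequentially"
  proof (rule uniform_limitI)
    fix e :: real assume "e > 0"
    then have "\<forall>\<^sub>F n in sequentially. tail n < e" using order_tendstoD(2)[OF tail] by blast
    then show "\<forall>\<^sub>F n in sequentially. \<forall>z\<in>cball z0 1. dist (integral (?I n) (?F z)) (gauss_laplace h z) < e"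
    proof eventually_elim
      case (elim n)
      show ?case
      proof
        fix z assume "z \<in> cball z0 1"
        then have "\<bar>Re (z - z0)\<bar> \<le> 1" using abs_Re_le_cmod[of "z - z0"] by (simp add: dist_norm norm_minus_commute)
        then have "\<bar>Re z\<bar> \<le> R" by (simp add: R_def)
        from tail_ge[OF this, of n] elim
        show "dist (integral (?I n) (?F z)) (gauss_laplace h z) < e" by simp
      qed
    qed
  qed
  then show "\<exists>d>0. cball z0 d \<subseteq> UNIV \<and> uniform_limit (cball z0 d) (\<lambda>n z. integral (?I n) (?F z)) (gauss_laplace h) sequentially"
    by (intro exI[of _ 1]) auto
qed auto

text \<open>This links the caloric function to the transform: expanding the square in
  \<open>exp (- (y - \<xi>)\<^sup>2 / 2)\<close> separates the factor \<open>exp (- \<xi>\<^sup>2 / 2)\<close> from an exponential in \<open>\<xi> y\<close>.\<close>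
lemma gauss_laplace_of_real:
  assumes "t > 0"
  shows "gauss_laplace (\<lambda>y. h (sqrt (2 * t) * y)) (of_real \<xi>)
     = of_real (exp (\<xi>\<^sup>2 / 2) * gauss_mean h (sqrt (2 * t) * \<xi>) t)"
proof -
  have "gauss_laplace (\<lambda>y. h (sqrt (2 * t) * y)) (of_real \<xi>)
      = (LINT y|lborel. complex_of_real (exp (\<xi>\<^sup>2 / 2) * (normal_density \<xi> 1 y * h (sqrt (2 * t) * y))))"
    unfolding gauss_laplace_def
  proof (rule Bochner_Integration.integral_cong[OF refl])
    fix y
    have "std_normal_density y * h (sqrt (2 * t) * y) * exp (\<xi> * y)
        = exp (\<xi>\<^sup>2 / 2) * (normal_density \<xi> 1 y * h (sqrt (2 * t) * y))"
      using std_normal_density_tilt[of y \<xi>] by (simp add: algebra_simps)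
    then show "complex_of_real (std_normal_density y * h (sqrt (2 * t) * y)) * exp (of_real \<xi> * of_real y)
       = complex_of_real (exp (\<xi>\<^sup>2 / 2) * (normal_density \<xi> 1 y * h (sqrt (2 * t) * y)))"
      by (metis exp_of_real of_real_mult)
  qed
  also have "\<dots> = of_real (exp (\<xi>\<^sup>2 / 2) * (LINT y|lborel. normal_density \<xi> 1 y * h (sqrt (2 * t) * y)))"
    by (simp only: integral_complex_of_real integral_mult_right_zero)
  also have "(LINT y|lborel. normal_density \<xi> 1 y * h (sqrt (2 * t) * y))
     = (LINT z|lborel. normal_density \<xi> 1 (\<xi> + z) * h (sqrt (2 * t) * (\<xi> + z)))"
    by (subst lborel_integral_real_affine[where c = 1 and t = \<xi>]) auto
  also have "\<dots> = gauss_mean h (sqrt (2 * t) * \<xi>) t"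
    by (simp add: gauss_mean_def normal_density_def distrib_left)
  finally show ?thesis .
qed

text \<open>Fourier inversion with a Gaussian regularisation: a Gaussian centred at \<open>x\<close> is a superposition of
  the characters \<open>exp (\<i> \<eta> (y - x))\<close>, since the characteristic function of the normal distribution is
  again Gaussian. Integrating each character against the weighted \<open>h\<close> gives \<open>0\<close>.\<close>
lemma gauss_mean_eq_zero_of_gauss_laplace:
  assumes zero: "\<And>\<eta>. gauss_laplace h (\<i> * of_real \<eta>) = 0" and t: "t > 0"
  shows "gauss_mean (\<lambda>y. std_normal_density y * h y) x t = 0"
proof -
  define \<sigma> where "\<sigma> = sqrt (2 * t)"
  have "\<sigma> > 0" using t by (simp add: \<sigma>_def)
  let ?q = "\<lambda>y. std_normal_density y * h y"
  let ?P = "\<lambda>w y. of_real (std_normal_density w) * (of_real (?q y) * iexp (w * ((y - x) / \<sigma>))) :: complex"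
  have char: "(LINT w|lborel. of_real (std_normal_density w) * iexp (w * s)) = complex_of_real (exp (- s\<^sup>2 / 2))" for s
  proof -
    have "complex_of_real (exp (- s\<^sup>2 / 2)) = (LINT w|density lborel std_normal_density. iexp (s * w))"
      using char_std_normal_distribution by (simp add: char_def fun_eq_iff)
    also have "\<dots> = (LINT w|lborel. std_normal_density w *\<^sub>R iexp (s * w))"
      by (rule integral_density) auto
    finally show ?thesis by (simp add: scaleR_conv_of_real mult.commute)
  qed
  have q_int: "integrable lborel (\<lambda>y. C * std_normal_density y)" by auto
  have q_le: "\<bar>?q y\<bar> \<le> C * std_normal_density y" for y
    using h_bdd[of y] by (simp add: abs_mult mult.commute[of C] mult_left_mono)
  have q_int': "integrable lborel (\<lambda>y. \<bar>?q y\<bar>)"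
    by (rule Bochner_Integration.integrable_bound[OF q_int]) (use q_le in \<open>auto intro: order_trans[OF _ abs_ge_self]\<close>)
  have int2: "integrable (lborel \<Otimes>\<^sub>M lborel) (\<lambda>(w, y). ?P w y)"
  proof (rule lborel_pair.Fubini_integrable)
    have norm_P: "norm (?P w y) = std_normal_density w * \<bar>?q y\<bar>" for w y
      by (simp add: norm_mult abs_mult)
    show "integrable lborel (\<lambda>w. LINT y|lborel. norm (case (w, y) of (w, y) \<Rightarrow> ?P w y))"
      unfolding prod.case norm_P by (simp add: q_int')
    show "AE w in lborel. integrable lborel (\<lambda>y. case (w, y) of (w, y) \<Rightarrow> ?P w y)"
    proof (rule AE_I2)
      fix w
      have "integrable lborel (?P w)"
        by (rule Bochner_Integration.integrable_bound[OF integrable_mult_right[OF q_int', of "std_normal_density w"]])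
          (auto simp: norm_mult abs_mult)
      then show "integrable lborel (\<lambda>y. case (w, y) of (w, y) \<Rightarrow> ?P w y)" by simp
    qed
  qed measurable
  have "(LINT y|lborel. LINT w|lborel. ?P w y) = (LINT w|lborel. LINT y|lborel. ?P w y)"
    by (rule lborel_pair.Fubini_integral[OF int2])
  also have "(\<lambda>w. LINT y|lborel. ?P w y) = (\<lambda>w. 0)"
  proof
    fix w
    have "(LINT y|lborel. ?P w y) = (LINT y|lborel. (of_real (std_normal_density w) * iexp (- w * x / \<sigma>))
        * (of_real (?q y) * exp ((\<i> * of_real (w / \<sigma>)) * of_real y)))"
    proof (rule Bochner_Integration.integral_cong[OF refl])
      fix y
      have "iexp (w * ((y - x) / \<sigma>)) = iexp (- w * x / \<sigma>) * exp ((\<i> * of_real (w / \<sigma>)) * of_real y)"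
        by (simp add: diff_divide_distrib algebra_simps flip: exp_add)
      then show "?P w y = (of_real (std_normal_density w) * iexp (- w * x / \<sigma>))
        * (of_real (?q y) * exp ((\<i> * of_real (w / \<sigma>)) * of_real y))"
        by (simp add: mult_ac)
    qed
    also have "\<dots> = of_real (std_normal_density w) * iexp (- w * x / \<sigma>) * gauss_laplace h (\<i> * of_real (w / \<sigma>))"
      unfolding gauss_laplace_def by (rule integral_mult_right_zero)
    also have "\<dots> = 0" unfolding zero by (rule mult_zero_right)
    finally show "(LINT y|lborel. ?P w y) = 0" .
  qed
  also have "(\<lambda>y. LINT w|lborel. ?P w y) = (\<lambda>y. of_real (exp (- ((y - x) / \<sigma>)\<^sup>2 / 2) * ?q y))"
  proof
    fix y
    have "(LINT w|lborel. ?P w y)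
       = (LINT w|lborel. of_real (?q y) * (of_real (std_normal_density w) * iexp (w * ((y - x) / \<sigma>))))"
      by (rule Bochner_Integration.integral_cong[OF refl]) (simp add: mult_ac)
    also have "\<dots> = of_real (?q y) * (LINT w|lborel. of_real (std_normal_density w) * iexp (w * ((y - x) / \<sigma>)))"
      by (rule integral_mult_right_zero)
    finally show "(LINT w|lborel. ?P w y) = of_real (exp (- ((y - x) / \<sigma>)\<^sup>2 / 2) * ?q y)"
      unfolding char by (simp add: mult_ac)
  qed
  finally have "complex_of_real (LINT y|lborel. exp (- ((y - x) / \<sigma>)\<^sup>2 / 2) * ?q y) = 0"
    by (simp only: integral_complex_of_real) simp
  then have "(LINT y|lborel. exp (- ((y - x) / \<sigma>)\<^sup>2 / 2) * ?q y) = 0" by (simp only: of_real_eq_0_iff)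
  then have "(LINT z|lborel. exp (- z\<^sup>2 / 2) * ?q (x + \<sigma> * z)) = 0"
    using \<open>\<sigma> > 0\<close> by (subst (asm) lborel_integral_real_affine[where c = \<sigma> and t = x]) auto
  moreover have "gauss_mean ?q x t = (LINT z|lborel. (1 / sqrt (2 * pi)) * (exp (- z\<^sup>2 / 2) * ?q (x + \<sigma> * z)))"
    unfolding gauss_mean_def \<sigma>_def[symmetric] by (simp add: std_normal_density_def mult.assoc)
  ultimately show ?thesis by (simp only: integral_mult_right_zero mult_zero_right)
qed

text \<open>The means of the previous lemma converge to the weighted function itself as \<open>t \<rightarrow> 0\<close>.\<close>
lemma gauss_laplace_injective:
  assumes "\<And>\<eta>. gauss_laplace h (\<i> * of_real \<eta>) = 0"
  shows "h x = 0"
proof -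
  let ?q = "\<lambda>y. std_normal_density y * h y"
  have q_cont: "continuous_on UNIV ?q"
    unfolding std_normal_density_def by (intro continuous_intros h_cont) auto
  have q_bdd: "\<bar>?q y\<bar> \<le> C" for y
  proof -
    have "std_normal_density y \<le> 1 * 1"
      unfolding std_normal_density_def
      by (intro mult_mono) (use pi_gt3 in \<open>auto intro!: real_le_rsqrt simp: divide_le_eq_1\<close>)
    then have "\<bar>?q y\<bar> \<le> 1 * C" unfolding abs_mult by (intro mult_mono h_bdd) auto
    then show ?thesis by simp
  qed
  have "(\<lambda>n. gauss_mean ?q x (1 / real (Suc n))) \<longlonglongrightarrow> gauss_mean ?q x 0"
  proof -
    have "isCont ?q y" for y using q_cont by (simp add: continuous_on_eq_continuous_at)
    then show ?thesis
      by (intro gauss_mean_tendsto[OF q_cont q_cont q_bdd] isCont_tendsto_compose[of _ ?q] tendsto_intros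
          LIMSEQ_inverse_real_of_nat[unfolded inverse_eq_divide])
  qed
  moreover have "gauss_mean ?q x (1 / real (Suc n)) = 0" for n
    by (rule gauss_mean_eq_zero_of_gauss_laplace[OF assms]) auto
  ultimately have "gauss_mean ?q x 0 = 0" by (simp add: LIMSEQ_const_iff)
  then show ?thesis using normal_density_pos[of 1 0 x] by auto
qed

end

section \<open>Decay forced by the zero curve\<close>

text \<open>The comparison function is the heat kernel with pole \<open>(a, g a / 2)\<close>. It is smooth only after time
  \<open>g a / 2\<close>, while the graph may come much closer to \<open>t = 0\<close> further to the right. Hence a
  first comparison, in which the side \<open>x = a\<close> does not occur since it enters the region only at time
  \<open>g a\<close>, shows that \<open>u\<close> vanishes above the graph up to time \<open>3/4 g a\<close>. This allows the graph to be
  raised to the height \<open>G \<ge> 3/4 g a\<close>, and the kernel is a valid barrier above \<open>G\<close>.\<close>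
lemma zero_curve_decay:
  fixes g :: "real \<Rightarrow> real" and u :: "real \<Rightarrow> real \<Rightarrow> real"
  assumes g: "continuous_on {a..} g" "\<And>x. x \<ge> a \<Longrightarrow> 0 < g x" "\<And>x. x \<ge> a \<Longrightarrow> g x \<le> T"
    and u: "\<And>x t. t > 0 \<Longrightarrow> heat_defect_at u x t 0"
    "continuous_on (UNIV \<times> {0..}) (\<lambda>(x, t). u x t)"
    "\<And>x t. t > 0 \<Longrightarrow> \<bar>u x t\<bar> \<le> C"
    and zero: "\<And>x. x \<ge> a \<Longrightarrow> u x (g x) = 0"
  shows "\<exists>B. \<forall>x\<ge>a. \<bar>u x T\<bar> \<le> B * exp (- (x - a)\<^sup>2 / (4 * (T - g a / 2)))"
proof -
  define \<delta> where "\<delta> = g a"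
  have \<delta>: "0 < \<delta>" "\<delta> \<le> T" using g by (auto simp: \<delta>_def)
  have "C \<ge> 0" using u(3)[of 1 0] by linarith
  have cont: "continuous_on {(x, t). a \<le> x \<and> G x \<le> t \<and> t \<le> S} (\<lambda>(x, t). u x t)"
    if "\<And>x. x \<ge> a \<Longrightarrow> 0 \<le> G x" for G S
    by (rule continuous_on_subset[OF u(2)]) (use that in force)
  have early: "u x t = 0" if "a \<le> x" "g x \<le> t" "t \<le> 3 / 4 * \<delta>" for x t
  proof -
    \<comment> \<open>Both signs \<open>\<sigma>\<close> are needed; the zero summand makes this a linear combination of two solutions.\<close>
    have "\<sigma> * u x t + 0 * u x t \<le> 0" if "\<bar>\<sigma>\<bar> = 1" for \<sigma>
    proof (rule comparison_above_graph[OF g(1), where T = "3 / 4 * \<delta>" and C = C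
            and d = "\<lambda>x t. \<sigma> * u x t + 0 * u x t"])
      show "0 \<le> g x" if "a \<le> x" for x using g(2)[OF that] by simp
      show "continuous_on {(x, t). a \<le> x \<and> g x \<le> t \<and> t \<le> 3 / 4 * \<delta>} (\<lambda>(x, t). \<sigma> * u x t + 0 * u x t)"
        using cont[of g "3 / 4 * \<delta>", OF less_imp_le[OF g(2)]] unfolding case_prod_unfold
        by (intro continuous_intros)
      show "\<sigma> * u y s + 0 * u y s \<le> C" if "a \<le> y" "g y \<le> s" for y s
        using u(3)[of s y] g(2)[of y] that \<open>\<bar>\<sigma>\<bar> = 1\<close> by (auto simp: abs_if split: if_splits)
      show "heat_defect_at (\<lambda>x t. \<sigma> * u x t + 0 * u x t) y s 0" if "a < y" "g y < s" for y s
      proof -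
        have "s > 0" using g(2)[of y] that by simp
        from heat_defect_at_lincomb[OF u(1)[OF this, of y] u(1)[OF this, of y], of \<sigma> 0]
        show ?thesis by simp
      qed
    qed (use \<delta> zero \<open>a \<le> x\<close> \<open>g x \<le> t\<close> \<open>t \<le> _\<close> in \<open>auto simp: \<delta>_def\<close>)
    from this[of 1] this[of "-1"] show ?thesis by simp
  qed
  define G where "G = (\<lambda>x. max (g x) (3 / 4 * \<delta>))"
  have u_G: "u x (G x) = 0" if "x \<ge> a" for x
    using that zero early[of x "3 / 4 * \<delta>"] by (auto simp: G_def max_def)
  define \<tau> where "\<tau> = \<delta> / 2"
  define w where "w = (\<lambda>x t. heat_kernel (x - a) (t - \<tau>))"
  \<comment> \<open>On the side \<open>x = a\<close> the kernel is \<open>1 / sqrt (4 \<pi> (t - \<tau>)) \<ge> 1 / sqrt (4 \<pi> T)\<close>, so \<open>D w \<ge> C\<close> there.\<close>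
  define D where "D = C * sqrt (4 * pi * T)"
  have "D \<ge> 0" using \<open>C \<ge> 0\<close> \<delta> by (simp add: D_def)
  have G_gt: "\<tau> < G x" "0 < G x" for x using \<delta> by (auto simp: G_def \<tau>_def)
  have w_nonneg: "w x t \<ge> 0" if "t > \<tau>" for x t
    using that by (simp add: w_def heat_kernel_def)
  have bound: "\<bar>u x T\<bar> \<le> D * w x T" if "x \<ge> a" for x
  proof -
    have "\<sigma> * u x T + (- D) * w x T \<le> 0" if "\<bar>\<sigma>\<bar> = 1" for \<sigma>
    proof (rule comparison_above_graph[where a = a and G = G and T = T and C = C
            and d = "\<lambda>x t. \<sigma> * u x t + - D * w x t"])
      show "continuous_on {a..} G" unfolding G_def by (intro continuous_intros g)
      show "0 \<le> G x" for x using G_gt[of x] by simp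
      show "continuous_on {(x, t). a \<le> x \<and> G x \<le> t \<and> t \<le> T} (\<lambda>(x, t). \<sigma> * u x t + - D * w x t)"
      proof -
        have "0 < snd p - \<tau>" if "p \<in> {(x, t). a \<le> x \<and> G x \<le> t \<and> t \<le> T}" for p
          using that G_gt(1)[of "fst p"] by auto
        then show ?thesis
          using cont[of G T, OF less_imp_le[OF G_gt(2)]] unfolding case_prod_unfold w_def
          by (intro continuous_intros) auto
      qed
      show "\<sigma> * u y s + - D * w y s \<le> C" if "a \<le> y" "G y \<le> s" for y s
      proof -
        have "\<sigma> * u y s \<le> C"
          using u(3)[of s y] G_gt[of y] that \<open>\<bar>\<sigma>\<bar> = 1\<close> by (auto simp: abs_if split: if_splits)
        moreover have "D * w y s \<ge> 0" using w_nonneg[of s y] G_gt[of y] that \<open>D \<ge> 0\<close> by simp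
        ultimately show ?thesis by simp
      qed
      show "heat_defect_at (\<lambda>x t. \<sigma> * u x t + - D * w x t) y s 0" if "G y < s" for y s
      proof -
        have "s > 0" "s > \<tau>" using G_gt[of y] that by auto
        from heat_defect_at_lincomb[OF u(1)[OF this(1), of y] heat_kernel_defect[OF this(2), of a y], of \<sigma> "- D"]
        show ?thesis by (simp add: w_def)
      qed
      show "\<sigma> * u a s + - D * w a s \<le> 0" if "G a \<le> s" "s \<le> T" for s
      proof -
        have s: "s > \<tau>" "s > 0" using G_gt[of a] that by auto
        have "sqrt (4 * pi * (s - \<tau>)) \<le> sqrt (4 * pi * T)"
          using that \<delta> by (intro real_sqrt_le_mono mult_left_mono) (auto simp: \<tau>_def)
        then have "1 \<le> sqrt (4 * pi * T) / sqrt (4 * pi * (s - \<tau>))" using s by simp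
        then have "C * 1 \<le> C * (sqrt (4 * pi * T) / sqrt (4 * pi * (s - \<tau>)))"
          using \<open>C \<ge> 0\<close> by (intro mult_left_mono)
        also have "\<dots> = D * w a s" by (simp add: D_def w_def heat_kernel_def)
        finally have "C \<le> D * w a s" by simp
        then show ?thesis
          using u(3)[of s a] s \<open>\<bar>\<sigma>\<bar> = 1\<close> by (auto simp: abs_if split: if_splits)
      qed
      show "\<sigma> * u y (G y) + - D * w y (G y) \<le> 0" if "a \<le> y" for y
        using u_G[OF that] w_nonneg[of "G y" y] G_gt[of y] \<open>D \<ge> 0\<close> by simp
      show "G x \<le> T" using g(3)[OF \<open>x \<ge> a\<close>] \<delta> by (simp add: G_def)
    qed (use \<open>x \<ge> a\<close> in auto)
    from this[of 1] this[of "-1"] show ?thesis by (simp add: abs_le_iff)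
  qed
  show ?thesis
  proof (intro exI allI impI)
    fix x assume "x \<ge> a"
    show "\<bar>u x T\<bar> \<le> D / sqrt (4 * pi * (T - \<tau>)) * exp (- (x - a)\<^sup>2 / (4 * (T - g a / 2)))"
      using bound[OF \<open>x \<ge> a\<close>] by (simp add: w_def heat_kernel_def \<tau>_def \<delta>_def)
  qed
qed

text \<open>The strict inequality \<open>1 / T < 1 / \<beta>\<close> leaves a definite quadratic gain, part of which absorbs the
  linear term created by the shift \<open>a\<close>.\<close>
lemma shifted_gaussian_gain:
  fixes a \<beta> T :: real
  assumes "0 < \<beta>" "\<beta> < T"
  shows "\<exists>c>0. \<exists>M. \<forall>x. x\<^sup>2 / T - (x - a)\<^sup>2 / \<beta> \<le> M - c * x\<^sup>2"
proof -
  define c where "c = (1 / \<beta> - 1 / T) / 2"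
  have "1 / T < 1 / \<beta>" using assms by (intro divide_strict_left_mono) auto
  then have "c > 0" by (simp add: c_def)
  have "c + c = 1 / \<beta> - 1 / T" unfolding c_def by (rule field_sum_of_halves)
  then have c2: "1 / T = 1 / \<beta> - 2 * c" by linarith
  have "x\<^sup>2 / T - (x - a)\<^sup>2 / \<beta> \<le> a\<^sup>2 / (c * \<beta>\<^sup>2) - c * x\<^sup>2" for x
  proof -
    have "0 \<le> (c * x - a / \<beta>)\<^sup>2 / c" using \<open>c > 0\<close> by simp
    also have "\<dots> = c * x\<^sup>2 - 2 * a * x / \<beta> + a\<^sup>2 / (c * \<beta>\<^sup>2)"
      using \<open>c > 0\<close> assms by (simp add: power2_eq_square field_simps)
    finally have 1: "2 * a * x / \<beta> \<le> c * x\<^sup>2 + a\<^sup>2 / (c * \<beta>\<^sup>2)" by simp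
    have "x\<^sup>2 / T = x\<^sup>2 * (1 / \<beta> - 2 * c)" using c2 by (simp add: divide_inverse)
    moreover have "(x - a)\<^sup>2 / \<beta> = x\<^sup>2 * (1 / \<beta>) - 2 * a * x / \<beta> + a\<^sup>2 / \<beta>"
      using assms by (simp add: power2_eq_square field_simps)
    moreover have "0 \<le> a\<^sup>2 / \<beta>" using assms by simp
    ultimately show ?thesis using 1 by (simp add: algebra_simps)
  qed
  with \<open>c > 0\<close> show ?thesis by blast
qed

text \<open>A solution at time \<open>T\<close> that decays to the right faster than the heat kernel of the same age must
  come from the zero datum. Multiplying by the inverse of \<open>exp (- x\<^sup>2 / (4 T))\<close> turns the excess decay
  into Gaussian decay of the Laplace transform on the positive axis.\<close>
theorem one_sided_gaussian_decay_imp_zero: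
  assumes f: "continuous_on UNIV f" "\<And>x. \<bar>f x\<bar> \<le> C"
    and \<beta>: "0 < \<beta>" "\<beta> < T"
    and decay: "\<And>x. x \<ge> a \<Longrightarrow> \<bar>gauss_mean f x T\<bar> \<le> B * exp (- (x - a)\<^sup>2 / (4 * \<beta>))"
  shows "f x = 0"
proof -
  \<comment> \<open>Scaling by \<open>\<rho>\<close> turns the heat kernel at time \<open>T\<close> into the standard normal density.\<close>
  define \<rho> where "\<rho> = sqrt (2 * T)"
  have \<rho>: "\<rho> > 0" "\<rho>\<^sup>2 = 2 * T" using \<beta> by (auto simp: \<rho>_def)
  define h where "h = (\<lambda>y. f (\<rho> * y))"
  have h: "continuous_on UNIV h" "\<And>y. \<bar>h y\<bar> \<le> C"
    unfolding h_def by (auto intro!: continuous_on_compose2[OF f(1)] continuous_intros f(2))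
  have "C \<ge> 0" using f(2)[of 0] by simp
  obtain c M where "c > 0" and gain: "\<And>x. x\<^sup>2 / T - (x - a)\<^sup>2 / \<beta> \<le> M - c * x\<^sup>2"
    using shifted_gaussian_gain[OF \<beta>, of a] by blast
  define k where "k = c * T / 2"
  have "k > 0" using \<open>c > 0\<close> \<beta> by (simp add: k_def)
  \<comment> \<open>The second term covers the arguments \<open>s < a / \<rho>\<close>, to which the decay hypothesis does not apply.\<close>
  define B' where "B' = max (\<bar>B\<bar> * exp (M / 4)) (C * exp ((a / \<rho>)\<^sup>2 / 2) * exp (k * (a / \<rho>)\<^sup>2)) + 1"
  have "B' > 0" by (simp add: B'_def add_nonneg_pos le_max_iff_disj)
  have "gauss_laplace h z = 0" for z
  proof (rule entire_gaussian_decay_imp_zero[where \<Psi> = "gauss_laplace h" and A = "C + 1" and D = "1 / 2" and B = B' and c = k])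
    show "gauss_laplace h holomorphic_on UNIV" by (rule gauss_laplace_holomorphic[OF h])
    show "norm (gauss_laplace h z) \<le> (C + 1) * exp (1 / 2 * (Re z)\<^sup>2)" for z
      using norm_gauss_laplace_le[OF h, of z] by (simp add: distrib_right add_increasing2)
    show "norm (gauss_laplace h (of_real s)) \<le> B' * exp (- k * s\<^sup>2)" if "s > 0" for s
    proof (cases "\<rho> * s \<ge> a")
      case True
      have "norm (gauss_laplace h (of_real s)) = exp (s\<^sup>2 / 2) * \<bar>gauss_mean f (\<rho> * s) T\<bar>"
        unfolding h_def \<rho>_def using gauss_laplace_of_real[OF f, of T s] \<beta> by (simp add: norm_mult abs_mult)
      also have "\<dots> \<le> exp (s\<^sup>2 / 2) * (\<bar>B\<bar> * exp (- (\<rho> * s - a)\<^sup>2 / (4 * \<beta>)))"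
        by (intro mult_left_mono order_trans[OF decay[OF True]] mult_right_mono) auto
      also have "\<dots> = \<bar>B\<bar> * exp (s\<^sup>2 / 2 + - (\<rho> * s - a)\<^sup>2 / (4 * \<beta>))"
        by (simp only: exp_add mult_ac)
      also have "\<dots> \<le> \<bar>B\<bar> * exp (M / 4 - k * s\<^sup>2)"
      proof -
        have "(\<rho> * s)\<^sup>2 = 2 * T * s\<^sup>2" using \<rho> by (simp add: power_mult_distrib)
        then have "s\<^sup>2 / 2 + - (\<rho> * s - a)\<^sup>2 / (4 * \<beta>) = ((\<rho> * s)\<^sup>2 / T - (\<rho> * s - a)\<^sup>2 / \<beta>) / 4"
          using \<beta> by (simp add: diff_divide_distrib)
        also have "\<dots> \<le> (M - c * (\<rho> * s)\<^sup>2) / 4" using gain by (intro divide_right_mono) auto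
        also have "\<dots> = M / 4 - k * s\<^sup>2"
          using \<open>(\<rho> * s)\<^sup>2 = 2 * T * s\<^sup>2\<close> by (simp add: k_def diff_divide_distrib)
        finally show ?thesis by (intro mult_left_mono) auto
      qed
      also have "\<dots> = (\<bar>B\<bar> * exp (M / 4)) * exp (- k * s\<^sup>2)"
        by (simp add: mult.assoc flip: exp_add)
      also have "\<dots> \<le> B' * exp (- k * s\<^sup>2)" by (intro mult_right_mono) (auto simp: B'_def)
      finally show ?thesis .
    next
      case False
      then have "s\<^sup>2 \<le> (a / \<rho>)\<^sup>2"
        using that \<rho> by (intro power_mono) (auto simp: field_simps)
      then have "C * exp (s\<^sup>2 / 2) * exp (k * s\<^sup>2) \<le> C * exp ((a / \<rho>)\<^sup>2 / 2) * exp (k * (a / \<rho>)\<^sup>2)"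
        using \<open>C \<ge> 0\<close> \<open>k > 0\<close> by (intro mult_mono) auto
      also have "\<dots> \<le> B'" by (simp add: B'_def)
      finally have "C * exp (s\<^sup>2 / 2) \<le> B' * exp (- k * s\<^sup>2)"
        by (simp add: exp_minus field_simps)
      with norm_gauss_laplace_le[OF h, of "of_real s"] show ?thesis by simp
    qed
  qed (use \<open>C \<ge> 0\<close> \<open>k > 0\<close> \<open>B' > 0\<close> in auto)
  then have "h (x / \<rho>) = 0" by (intro gauss_laplace_injective[OF h])
  then show ?thesis using \<rho> by (simp add: h_def)
qed

section \<open>Vanishing of the initial datum\<close>

theorem theorem1:
  fixes g f :: "real \<Rightarrow> real" and u :: "real \<Rightarrow> real \<Rightarrow> real"
  assumes "continuous_on {0<..} g"
    and "bounded (g ` {0<..})"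
    and "\<And>x. x > 0 \<Longrightarrow> g x > 0"
    and "continuous_on UNIV f"
    and "bounded (range f)"
    and "bounded_heat_ivp_solution f u"
    and "\<And>x. x > 0 \<Longrightarrow> u x (g x) = 0"
  shows "\<forall>x. u x 0 = 0"
proof -
  have sol: "bounded ((\<lambda>(x, t). u x t) ` (UNIV \<times> {0<..}))" "classical_heat_solution u"
    "continuous_on (UNIV \<times> {0..}) (\<lambda>(x, t). u x t)" "\<And>x. u x 0 = f x"
    using assms(6) by (auto simp: bounded_heat_ivp_solution_def)
  obtain C1 C2 where "\<And>x t. t > 0 \<Longrightarrow> \<bar>u x t\<bar> \<le> C1" "\<And>x. \<bar>f x\<bar> \<le> C2"
    using sol(1) assms(5) by (auto simp: bounded_iff)
  then have C: "\<And>x t. t > 0 \<Longrightarrow> \<bar>u x t\<bar> \<le> max C1 C2" "\<And>x. \<bar>f x\<bar> \<le> max C1 C2"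
    by (auto simp: le_max_iff_disj)
  obtain T where "\<And>x. x > 0 \<Longrightarrow> \<bar>g x\<bar> \<le> T"
    using assms(2) by (auto simp: bounded_iff)
  then have T: "\<And>x. x > 0 \<Longrightarrow> g x \<le> T" by (meson abs_le_D1)
  have heat: "\<And>x t. t > 0 \<Longrightarrow> heat_defect_at u x t 0"
    by (rule classical_heat_solution_defect[OF sol(2)])
  have "g 1 > 0" "g 1 \<le> T" using assms(3) T by auto
  have "\<exists>B. \<forall>x\<ge>1. \<bar>u x T\<bar> \<le> B * exp (- (x - 1)\<^sup>2 / (4 * (T - g 1 / 2)))"
    by (rule zero_curve_decay[OF _ _ _ heat sol(3) C(1)])
      (use assms T in \<open>auto intro: continuous_on_subset\<close>)
  then obtain B where B: "\<And>x. x \<ge> 1 \<Longrightarrow> \<bar>u x T\<bar> \<le> B * exp (- (x - 1)\<^sup>2 / (4 * (T - g 1 / 2)))"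
    by blast
  have rep: "u x T = gauss_mean f x T" for x
    by (rule bounded_heat_solution_eq_gauss_mean[OF assms(4) C(2) heat sol(3) C(1) sol(4)])
      (use \<open>g 1 > 0\<close> \<open>g 1 \<le> T\<close> in auto)
  have "f x = 0" for x
    by (rule one_sided_gaussian_decay_imp_zero[OF assms(4) C(2), where a = 1 and T = T and \<beta> = "T - g 1 / 2" and B = B])
      (use B \<open>g 1 > 0\<close> \<open>g 1 \<le> T\<close> in \<open>auto simp: rep\<close>)
  then show ?thesis using sol(4) by simp
qed

end
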